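(* Let $n\geq 1$, let $\rho_n:\mathfrak{sl}(2,\mathbb{C})\to\mathfrak{sl}(n+1,\mathbb{C})$ be the irreducible $(n+1)$-dimensional (complex linear) representation of $\mathfrak{sl}(2,\mathbb{C})$, and let $G_1=\langle\exp\rho_n(\mathfrak{sl}(2,\mathbb{C}))\rangle\subset \mathrm{Sl}(n+1,\mathbb{C})$. Suppose that $\Gamma\subset\mathrm{Sl}(n+1,\mathbb{C})$ is a subset containing $G_1$ such that the group generated by $\Gamma$ is Zariski dense. Then $\Gamma$ generates $\mathrm{Sl}(n+1,\mathbb{C})$ as a semigroup.
   Context: $\langle\exp\mathfrak{h}\rangle$ denotes the connected Lie subgroup generated by $\exp\mathfrak{h}$. For a connected semi-simple Lie group $G$ (a complex group being regarded as a real Lie group), a subset $B\subset G$ is Zariski dense if $\mathrm{Ad}(B)$ is dense in $\mathrm{Ad}(G)$ for the Zariski topology of the real algebraic group $\mathrm{Ad}(G)\subset\mathrm{GL}(\mathfrak{g})$. "$\Gamma$ generates $G$ as a semigroup" means that every element of $G$ is a finite product of elements of $\Gamma$. *)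

theory Defs
  imports "HOL-Analysis.Analysis" "HOL-Algebra.Generated_Groups"
begin

section \<open>The group Sl and its Lie algebra\<close>

definition SL :: "(complex^'m^'m) monoid" where
  "SL = \<lparr>carrier = {A. det A = 1}, mult = (**), one = mat 1\<rparr>"

definition sl :: "(complex^'m^'m) set" where
  "sl = {X. trace X = 0}"

definition lie_bracket :: "complex^'m^'m \<Rightarrow> complex^'m^'m \<Rightarrow> complex^'m^'m" where
  "lie_bracket X Y = X ** Y - Y ** X"

definition cscale :: "complex \<Rightarrow> complex^'m^'m \<Rightarrow> complex^'m^'m" where
  "cscale c X = (\<chi> i j. c * X $ i $ j)"

text \<open>The library's \<open>*\<close> on the type of matrices is the entrywise product, so its powers are
  not matrix powers.\<close>

definition matrix_power :: "complex^'m^'m \<Rightarrow> nat \<Rightarrow> complex^'m^'m" where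
  "matrix_power X k = (((**) X) ^^ k) (mat 1)"

definition matrix_exp :: "complex^'m^'m \<Rightarrow> complex^'m^'m" where
  "matrix_exp X = (\<Sum>k. (1 / fact k) *\<^sub>R matrix_power X k)"

lemma summable_matrix_exp:
  fixes X :: "complex^'m^'m"
  shows "summable (\<lambda>k. (1 / fact k) *\<^sub>R matrix_power X k)"
proof -
  have "bilinear ((**) :: complex^'m^'m \<Rightarrow> complex^'m^'m \<Rightarrow> complex^'m^'m)"
    unfolding bilinear_def
    by (auto intro!: linearI simp: matrix_add_ldistrib matrix_matrix_mult_def vec_eq_iff
        sum.distrib algebra_simps scaleR_sum_right)
  then interpret bounded_bilinear "(**) :: complex^'m^'m \<Rightarrow> complex^'m^'m \<Rightarrow> complex^'m^'m"
    by (simp add: bilinear_conv_bounded_bilinear)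
  obtain K where K: "K \<ge> 0" "\<And>(A :: complex^'m^'m) (B :: complex^'m^'m). norm (A ** B) \<le> norm A * norm B * K"
    using nonneg_bounded by metis
  define c where "c = norm (mat 1 :: complex^'m^'m)"
  have pw: "norm (matrix_power X k) \<le> c * (norm X * K) ^ k" for k
  proof (induction k)
    case 0
    show ?case by (simp add: matrix_power_def c_def)
  next
    case (Suc k)
    have "norm (matrix_power X (Suc k)) \<le> norm X * norm (matrix_power X k) * K"
      using K(2) by (simp add: matrix_power_def)
    also have "\<dots> \<le> norm X * (c * (norm X * K) ^ k) * K"
      using Suc K(1) by (intro mult_right_mono mult_left_mono) auto
    finally show ?case by (simp add: algebra_simps)
  qed
  have "summable (\<lambda>k. c * (inverse (fact k) * (norm X * K) ^ k))"
    by (intro summable_mult summable_exp)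
  then show ?thesis
  proof (rule summable_comparison_test')
    fix k :: nat
    show "norm ((1 / fact k) *\<^sub>R matrix_power X k) \<le> c * (inverse (fact k) * (norm X * K) ^ k)"
      using mult_left_mono[OF pw[of k], of "inverse (fact k)"] by (simp add: field_simps)
  qed
qed

lemma group_SL: "group (SL :: (complex^'m^'m) monoid)"
proof (rule groupI)
  fix A :: "complex^'m^'m"
  assume "A \<in> carrier SL"
  then have A: "det A = 1" by (simp add: SL_def)
  then obtain B where B: "B ** A = mat 1"
    by (metis invertible_def invertible_det_nz zero_neq_one)
  then have "det B = 1" using A det_mul[of B A] by simp
  then show "\<exists>B\<in>carrier SL. B \<otimes>\<^bsub>SL\<^esub> A = \<one>\<^bsub>SL\<^esub>" using B by (auto simp: SL_def)
qed (auto simp: SL_def det_mul matrix_mul_assoc)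


section \<open>Representations\<close>

text \<open>Only the values of \<open>\<rho>\<close> on \<open>sl\<close> matter.\<close>

definition sl2_representation :: "(complex^2^2 \<Rightarrow> complex^'m^'m) \<Rightarrow> bool" where
  "sl2_representation \<rho> \<longleftrightarrow>
     \<rho> \<in> sl \<rightarrow> sl \<and>
     (\<forall>X\<in>sl. \<forall>Y\<in>sl. \<rho> (X + Y) = \<rho> X + \<rho> Y) \<and>
     (\<forall>c. \<forall>X\<in>sl. \<rho> (cscale c X) = cscale c (\<rho> X)) \<and>
     (\<forall>X\<in>sl. \<forall>Y\<in>sl. \<rho> (lie_bracket X Y) = lie_bracket (\<rho> X) (\<rho> Y))"

text \<open>\<open>vec.subspace\<close> refers to complex subspaces here.  The representation space is
  nonzero because the index type is nonempty.\<close>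

definition irreducible_sl2_representation :: "(complex^2^2 \<Rightarrow> complex^'m^'m) \<Rightarrow> bool" where
  "irreducible_sl2_representation \<rho> \<longleftrightarrow>
     sl2_representation \<rho> \<and>
     (\<forall>W :: (complex^'m) set.
        vec.subspace W \<longrightarrow> (\<forall>X\<in>sl. \<forall>w\<in>W. \<rho> X *v w \<in> W) \<longrightarrow> W = {0} \<or> W = UNIV)"

text \<open>The connected Lie subgroup generated by the exponentials of a subalgebra is, as a set,
  the abstract subgroup they generate.\<close>

definition exp_subgroup :: "(complex^'m^'m) set \<Rightarrow> (complex^'m^'m) set" where
  "exp_subgroup \<hh> = generate SL (matrix_exp ` \<hh>)"


section \<open>Generation as a semigroup\<close>

definition generates_as_semigroup :: "('a, 'b) monoid_scheme \<Rightarrow> 'a set \<Rightarrow> bool" where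
  "generates_as_semigroup G B \<longleftrightarrow>
     (\<forall>g\<in>carrier G. \<exists>xs. xs \<noteq> [] \<and> set xs \<subseteq> B \<and> g = foldr (mult G) xs \<one>\<^bsub>G\<^esub>)"


section \<open>Zariski topology\<close>

text \<open>The group of real linear automorphisms of a real subspace \<open>V\<close>; its elements are normalised
  to be \<open>undefined\<close> off \<open>V\<close>.\<close>

definition GL_on :: "'v::real_vector set \<Rightarrow> ('v \<Rightarrow> 'v) set" where
  "GL_on V = {T \<in> extensional V. bij_betw T V V \<and>
     (\<forall>X\<in>V. \<forall>Y\<in>V. T (X + Y) = T X + T Y) \<and> (\<forall>r. \<forall>X\<in>V. T (r *\<^sub>R X) = r *\<^sub>R T X)}"

text \<open>Real polynomial functions on the space of endomorphisms of \<open>V\<close>: the real algebra generated by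
  the matrix coefficients \<open>T \<mapsto> l (T X)\<close>, i.e. the polynomials in the entries of \<open>T\<close> with respect to
  a basis of \<open>V\<close>.\<close>

inductive polynomial_on_End :: "'v::real_vector set \<Rightarrow> (('v \<Rightarrow> 'v) \<Rightarrow> real) \<Rightarrow> bool"
  for V where
  coeff: "X \<in> V \<Longrightarrow> linear l \<Longrightarrow> polynomial_on_End V (\<lambda>T. l (T X))"
| const: "polynomial_on_End V (\<lambda>T. c)"
| add: "polynomial_on_End V p \<Longrightarrow> polynomial_on_End V q \<Longrightarrow> polynomial_on_End V (\<lambda>T. p T + q T)"
| mult: "polynomial_on_End V p \<Longrightarrow> polynomial_on_End V q \<Longrightarrow> polynomial_on_End V (\<lambda>T. p T * q T)"

text \<open>Regular functions on \<open>GL_on V\<close> are polynomials divided by powers of the determinant, so their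
  common zero sets are those of polynomials.\<close>

definition zero_locus :: "'v::real_vector set \<Rightarrow> (('v \<Rightarrow> 'v) \<Rightarrow> real) set \<Rightarrow> ('v \<Rightarrow> 'v) set" where
  "zero_locus V P = {T \<in> GL_on V. \<forall>p\<in>P. p T = 0}"

definition zariski_topology :: "'v::real_vector set \<Rightarrow> ('v \<Rightarrow> 'v) topology" where
  "zariski_topology V =
     topology (\<lambda>U. \<exists>P. P \<subseteq> Collect (polynomial_on_End V) \<and> U = GL_on V - zero_locus V P)"

lemma openin_zariski:
  "openin (zariski_topology V) U \<longleftrightarrow>
     (\<exists>P. P \<subseteq> Collect (polynomial_on_End V) \<and> U = GL_on V - zero_locus V P)"
proof -
  let ?L = "\<lambda>U. \<exists>P. P \<subseteq> Collect (polynomial_on_End V) \<and> U = GL_on V - zero_locus V P"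
  have "istopology ?L"
    unfolding istopology_def
  proof (intro conjI allI impI)
    fix S T assume "?L S" "?L T"
    then obtain P Q where P: "P \<subseteq> Collect (polynomial_on_End V)" "S = GL_on V - zero_locus V P"
      and Q: "Q \<subseteq> Collect (polynomial_on_End V)" "T = GL_on V - zero_locus V Q"
      by blast
    let ?R = "{(\<lambda>T. p T * q T) | p q. p \<in> P \<and> q \<in> Q}"
    have "?R \<subseteq> Collect (polynomial_on_End V)"
      using P(1) Q(1) by (auto intro!: polynomial_on_End.mult)
    moreover have "S \<inter> T = GL_on V - zero_locus V ?R"
    proof (intro equalityI subsetI)
      fix x assume "x \<in> S \<inter> T"
      then obtain p q where x: "x \<in> GL_on V" "p \<in> P" "q \<in> Q" "p x \<noteq> 0" "q x \<noteq> 0"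
        using P(2) Q(2) by (auto simp: zero_locus_def)
      then have "(\<lambda>T. p T * q T) \<in> ?R" "(\<lambda>T. p T * q T) x \<noteq> 0" by auto
      then show "x \<in> GL_on V - zero_locus V ?R"
        unfolding zero_locus_def using x(1)
        by (metis (mono_tags, lifting) DiffI mem_Collect_eq)
    next
      fix x assume "x \<in> GL_on V - zero_locus V ?R"
      then show "x \<in> S \<inter> T"
        using P(2) Q(2) by (auto simp: zero_locus_def)
    qed
    ultimately show "?L (S \<inter> T)" by blast
  next
    fix \<K> assume "\<forall>K\<in>\<K>. ?L K"
    then obtain F where F: "\<And>K. K \<in> \<K> \<Longrightarrow> F K \<subseteq> Collect (polynomial_on_End V)"
      "\<And>K. K \<in> \<K> \<Longrightarrow> K = GL_on V - zero_locus V (F K)"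
      by metis
    have "\<Union>\<K> = (\<Union>K\<in>\<K>. GL_on V - zero_locus V (F K))"
      using F(2) by auto
    also have "\<dots> = GL_on V - zero_locus V (\<Union>K\<in>\<K>. F K)"
      by (auto simp: zero_locus_def)
    finally show "?L (\<Union>\<K>)" using F(1) by (intro exI[of _ "\<Union>K\<in>\<K>. F K"]) auto
  qed
  then show ?thesis unfolding zariski_topology_def by simp
qed

lemma topspace_zariski: "topspace (zariski_topology V) = GL_on V"
proof
  show "topspace (zariski_topology V) \<subseteq> GL_on V"
    by (auto simp: topspace_def openin_zariski)
  have "openin (zariski_topology V) (GL_on V)"
    unfolding openin_zariski
    by (intro exI[of _ "{\<lambda>T. 1}"]) (auto simp: zero_locus_def intro: polynomial_on_End.const)
  then show "GL_on V \<subseteq> topspace (zariski_topology V)" by (rule openin_subset)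
qed

lemma closedin_zariski:
  "closedin (zariski_topology V) Z \<longleftrightarrow>
     (\<exists>P. P \<subseteq> Collect (polynomial_on_End V) \<and> Z = zero_locus V P)"
proof -
  have *: "zero_locus V P \<subseteq> GL_on V" for P by (auto simp: zero_locus_def)
  show ?thesis
    unfolding closedin_def topspace_zariski openin_zariski
    by (metis "*" Diff_Diff_Int Diff_subset inf.absorb_iff2 inf_commute)
qed

text \<open>The adjoint representation of Sl on its Lie algebra; only the real structure of the latter is
  used below.\<close>

definition Ad :: "complex^'m^'m \<Rightarrow> complex^'m^'m \<Rightarrow> complex^'m^'m" where
  "Ad A = (\<lambda>X\<in>sl. A ** X ** matrix_inv A)"

definition zariski_dense :: "(complex^'m^'m) set \<Rightarrow> bool" where
  "zariski_dense B \<longleftrightarrow>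
     subtopology (zariski_topology sl) (Ad ` carrier SL) closure_of (Ad ` B) = Ad ` carrier SL"

lemma Ad_in_GL_on:
  fixes A :: "complex^'m^'m"
  assumes "A \<in> carrier SL"
  shows "Ad A \<in> GL_on sl"
proof -
  have "invertible A" using assms by (simp add: SL_def invertible_det_nz)
  then have inv: "A ** matrix_inv A = mat 1" "matrix_inv A ** A = mat 1"
    unfolding invertible_def matrix_inv_def by (rule someI2_ex; simp)+
  have tr: "trace (A ** X ** matrix_inv A) = trace X"
       "trace (matrix_inv A ** X ** A) = trace X" for X
    using inv by (metis trace_mul_sym matrix_mul_assoc matrix_mul_lid)+
  have canc: "matrix_inv A ** (A ** X ** matrix_inv A) ** A = X"
       "A ** (matrix_inv A ** X ** A) ** matrix_inv A = X" for X
    using inv by (metis matrix_mul_assoc matrix_mul_lid matrix_mul_rid)+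
  have add: "X + Y \<in> sl" if "X \<in> sl" "Y \<in> sl" for X Y :: "complex^'m^'m"
    using that by (simp add: sl_def trace_add)
  have scale: "r *\<^sub>R X \<in> sl" if "X \<in> sl" for r and X :: "complex^'m^'m"
    using that by (simp add: sl_def trace_def flip: scaleR_sum_right)
  have "bij_betw (Ad A) sl sl"
    by (rule bij_betw_byWitness[where f' = "\<lambda>X. matrix_inv A ** X ** A"])
       (use tr canc in \<open>auto simp: Ad_def sl_def\<close>)
  moreover have "A ** (X + Y) ** B = A ** X ** B + A ** Y ** B" for X Y B :: "complex^'m^'m"
    by (simp add: matrix_matrix_mult_def vec_eq_iff sum.distrib algebra_simps)
  moreover have "A ** (r *\<^sub>R X) ** B = r *\<^sub>R (A ** X ** B)" for r and X B :: "complex^'m^'m"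
    by (simp add: matrix_matrix_mult_def vec_eq_iff scaleR_sum_right sum_distrib_right)
  ultimately show ?thesis
    by (auto simp: GL_on_def Ad_def add scale)
qed

end

theory Submission
  imports Defs
begin

text \<open>The image of a root vector of \<open>sl(2)\<close> is a nonzero nilpotent matrix \<open>Z\<close>, and the semigroup
  \<open>S\<close> generated by \<open>\<Gamma>\<close> contains \<open>exp (z Z)\<close> for all complex \<open>z\<close>. These matrices depend
  polynomially on \<open>z\<close>, so products \<open>s\<^sub>1 exp (z\<^sub>1 Z) s\<^sub>2 exp (z\<^sub>2 Z) \<dots>\<close> with \<open>s\<^sub>i \<in> S\<close> are polynomial
  maps from complex affine spaces into \<open>S\<close>. By Zariski density and simplicity of the Lie algebra the
  conjugates of the complex line through \<open>Z\<close> under \<open>S\<close> span it, hence one of these maps has a surjective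
  derivative at some point. As in Chevalley's theorem on constructible sets, the image of such a map
  contains the complement of a hypersurface. So \<open>S\<close> contains a dense open subset of the group, which
  meets \<open>g S\<^sup>-\<^sup>1\<close> for every \<open>g\<close>.\<close>

section \<open>Polynomial functions of several complex variables\<close>

text \<open>A semigroup offers no inverses, no closedness and no Lie algebra to start from, so the
  argument works only with polynomial maps whose values lie in it. Complex parameters are essential:
  the complement of a complex hypersurface is connected, whereas that of a real one need not be, and
  a real polynomial map with invertible derivative somewhere may omit an open set, as squaring does.
  The matrices of determinant 1 do not form an affine space; to have source and target of equal
  dimension, a map into them is multiplied by diagonal matrices of varying determinant and so
  becomes a map of the full matrix space to itself, and this factor is divided out afterwards. All
  maps have the full matrix space as their source: a new factor adds no variables but takes over one
  direction of those present. Inverses in the group generated by \<open>\<Gamma>\<close> are dealt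
  with by finite dimension: an injective linear map of the span of the conjugates into itself is
  onto.\<close>

inductive polynomial_fn :: "(complex^'n \<Rightarrow> complex) \<Rightarrow> bool" where
  const: "polynomial_fn (\<lambda>z. c)"
| coord: "polynomial_fn (\<lambda>z. z $ i)"
| add: "polynomial_fn p \<Longrightarrow> polynomial_fn q \<Longrightarrow> polynomial_fn (\<lambda>z. p z + q z)"
| mult: "polynomial_fn p \<Longrightarrow> polynomial_fn q \<Longrightarrow> polynomial_fn (\<lambda>z. p z * q z)"

lemma polynomial_fn_sum:
  "(\<And>x. x \<in> A \<Longrightarrow> polynomial_fn (f x)) \<Longrightarrow> polynomial_fn (\<lambda>z. \<Sum>x\<in>A. f x z)"
  by (induction A rule: infinite_finite_induct) (auto intro: polynomial_fn.intros)

lemma polynomial_fn_prod: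
  "(\<And>x. x \<in> A \<Longrightarrow> polynomial_fn (f x)) \<Longrightarrow> polynomial_fn (\<lambda>z. \<Prod>x\<in>A. f x z)"
  by (induction A rule: infinite_finite_induct) (auto intro: polynomial_fn.intros)

lemma polynomial_fn_power: "polynomial_fn p \<Longrightarrow> polynomial_fn (\<lambda>z. p z ^ k)"
  by (induction k) (auto intro: polynomial_fn.intros)

lemma polynomial_fn_diff:
  assumes "polynomial_fn p" "polynomial_fn q"
  shows "polynomial_fn (\<lambda>z. p z - q z)"
  using polynomial_fn.add[OF assms(1) polynomial_fn.mult[OF polynomial_fn.const[of "-1"] assms(2)]]
  by simp

lemma polynomial_fn_det:
  fixes A :: "complex^'n \<Rightarrow> complex^'k^'k"
  assumes "\<And>i j. polynomial_fn (\<lambda>z. A z $ i $ j)"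
  shows "polynomial_fn (\<lambda>z. det (A z))"
  unfolding det_def
  by (intro polynomial_fn_sum polynomial_fn.mult polynomial_fn.const polynomial_fn_prod assms)

lemma polynomial_fn_compose:
  fixes f :: "complex^'n \<Rightarrow> complex^'k"
  assumes "polynomial_fn p" "\<And>i. polynomial_fn (\<lambda>z. f z $ i)"
  shows "polynomial_fn (\<lambda>z. p (f z))"
  using assms(1) by induction (auto intro: polynomial_fn.intros assms(2))

lemma continuous_on_polynomial_fn: "polynomial_fn p \<Longrightarrow> continuous_on A p"
  by (induction rule: polynomial_fn.induct) (auto intro!: continuous_intros)

text \<open>The derivative of the library is real linear. Recording it as a complex gradient with
  polynomial entries makes the Jacobian determinant of a polynomial map again a complex polynomial,
  so that the critical points form a hypersurface.\<close>

lemma polynomial_fn_has_gradient: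
  fixes p :: "complex^'n \<Rightarrow> complex"
  assumes "polynomial_fn p"
  shows "\<exists>D. (\<forall>i. polynomial_fn (D i)) \<and>
             (\<forall>z. (p has_derivative (\<lambda>h. \<Sum>i\<in>UNIV. D i z * h $ i)) (at z))"
  using assms
proof induction
  case (const c)
  show ?case
    by (intro exI[of _ "\<lambda>i z. 0"]) (simp add: polynomial_fn.const)
next
  case (coord j)
  have eq: "(\<lambda>h. \<Sum>i\<in>UNIV. (if i = j then 1 else 0) * h $ i) = (\<lambda>h::complex^'n. h $ j)"
    by (simp add: mult_delta_left)
  show ?case
  proof (intro exI[of _ "\<lambda>i z. if i = j then 1 else 0"] conjI allI)
    fix i show "polynomial_fn (\<lambda>z::complex^'n. if i = j then 1 else 0)"
      by (rule polynomial_fn.const)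
  next
    fix z :: "complex^'n"
    show "((\<lambda>z. z $ j) has_derivative (\<lambda>h. \<Sum>i\<in>UNIV. (if i = j then 1 else 0) * h $ i)) (at z)"
      unfolding eq by (rule bounded_linear_imp_has_derivative[OF bounded_linear_vec_nth])
  qed
next
  case (add p q)
  from add.IH obtain D E where D: "\<forall>i. polynomial_fn (D i)" "\<forall>i. polynomial_fn (E i)"
    "\<forall>z. (p has_derivative (\<lambda>h. \<Sum>i\<in>UNIV. D i z * h $ i)) (at z)"
    "\<forall>z. (q has_derivative (\<lambda>h. \<Sum>i\<in>UNIV. E i z * h $ i)) (at z)"
    by (elim exE conjE)
  note D = D[rule_format]
  show ?case
  proof (intro exI[of _ "\<lambda>i z. D i z + E i z"] conjI allI)
    fix i show "polynomial_fn (\<lambda>z. D i z + E i z)"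
      by (intro polynomial_fn.add D)
  next
    fix z
    show "((\<lambda>z. p z + q z) has_derivative (\<lambda>h. \<Sum>i\<in>UNIV. (D i z + E i z) * h $ i)) (at z)"
      by (rule has_derivative_eq_rhs[OF has_derivative_add[OF D(3,4)]])
         (simp add: sum.distrib distrib_right)
  qed
next
  case (mult p q)
  from mult.IH obtain D E where D: "\<forall>i. polynomial_fn (D i)" "\<forall>i. polynomial_fn (E i)"
    "\<forall>z. (p has_derivative (\<lambda>h. \<Sum>i\<in>UNIV. D i z * h $ i)) (at z)"
    "\<forall>z. (q has_derivative (\<lambda>h. \<Sum>i\<in>UNIV. E i z * h $ i)) (at z)"
    by (elim exE conjE)
  note D = D[rule_format]
  show ?case
  proof (intro exI[of _ "\<lambda>i z. p z * E i z + D i z * q z"] conjI allI)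
    fix i show "polynomial_fn (\<lambda>z. p z * E i z + D i z * q z)"
      by (intro polynomial_fn.add polynomial_fn.mult D mult.hyps)
  next
    fix z
    show "((\<lambda>z. p z * q z) has_derivative (\<lambda>h. \<Sum>i\<in>UNIV. (p z * E i z + D i z * q z) * h $ i)) (at z)"
      by (rule has_derivative_eq_rhs[OF has_derivative_mult[OF D(3,4)]])
         (auto simp: sum.distrib sum_distrib_left sum_distrib_right algebra_simps)
  qed
qed

text \<open>Restriction to complex lines reduces density and connectedness of nonvanishing sets to
  the finiteness of the roots of a polynomial in one variable.\<close>

lemma polynomial_fn_on_line:
  fixes p :: "complex^'n \<Rightarrow> complex"
  assumes "polynomial_fn p"
  shows "\<exists>q. \<forall>t. p (x + t *s v) = poly q t"
  using assms
proof induction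
  case (const c)
  show ?case by (intro exI[of _ "[:c:]"]) auto
next
  case (coord i)
  show ?case by (intro exI[of _ "[:x $ i, v $ i:]"]) auto
next
  case (add p q)
  from add.IH obtain P Q where "\<forall>t. p (x + t *s v) = poly P t" "\<forall>t. q (x + t *s v) = poly Q t"
    by (elim exE)
  then show ?case by (intro exI[of _ "P + Q"]) auto
next
  case (mult p q)
  from mult.IH obtain P Q where "\<forall>t. p (x + t *s v) = poly P t" "\<forall>t. q (x + t *s v) = poly Q t"
    by (elim exE)
  then show ?case by (intro exI[of _ "P * Q"]) auto
qed

lemma finite_zeros_on_line:
  assumes "polynomial_fn p" "p (x + t0 *s v) \<noteq> 0"
  shows "finite {t. p (x + t *s v) = 0}"
proof -
  obtain q where q: "\<And>t. p (x + t *s v) = poly q t"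
    using polynomial_fn_on_line[OF assms(1)] by blast
  then have "q \<noteq> 0" using assms(2) by auto
  then show ?thesis using poly_roots_finite q by simp
qed

lemma norm_vector_scalar_mult: "norm (c *s (v :: complex^'n)) = cmod c * norm v"
  by (simp add: norm_vec_def vector_scalar_mult_def norm_mult L2_set_right_distrib)

lemma polynomial_fn_nonzero_near:
  fixes p :: "complex^'n \<Rightarrow> complex"
  assumes "polynomial_fn p" "p y \<noteq> 0" "open U" "x \<in> U"
  shows "\<exists>z\<in>U. p z \<noteq> 0"
proof -
  obtain e where e: "e > 0" "ball x e \<subseteq> U" using assms(3,4) open_contains_ball by blast
  let ?v = "y - x"
  have "p (x + 1 *s ?v) \<noteq> 0" using assms(2) by simp
  then have fin: "finite {t. p (x + t *s ?v) = 0}" by (rule finite_zeros_on_line[OF assms(1)])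
  \<comment> \<open>For \<open>t\<close> in the disc of this radius, \<open>t *s ?v\<close> has norm
    below \<open>e\<close>; the added 1 covers the case \<open>y = x\<close>.\<close>
  have pos: "e / (norm ?v + 1) > 0" using e by (simp add: add_nonneg_pos)
  have "infinite (ball (0::complex) (e / (norm ?v + 1)))"
    using finite_imp_not_open[OF _ open_ball] pos by (metis ball_eq_empty not_le)
  then have "\<not> ball (0::complex) (e / (norm ?v + 1)) \<subseteq> {t. p (x + t *s ?v) = 0}"
    using fin finite_subset by blast
  then obtain t where t: "t \<in> ball 0 (e / (norm ?v + 1))" "p (x + t *s ?v) \<noteq> 0"
    by blast
  have "norm (t *s ?v) < e"
  proof -
    have "cmod t * norm ?v \<le> cmod t * (norm ?v + 1)" by (simp add: mult_left_mono)
    also have "\<dots> < e" using t(1) by (simp add: pos_less_divide_eq add_nonneg_pos)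
    finally show ?thesis by (simp only: norm_vector_scalar_mult)
  qed
  then have "x + t *s ?v \<in> ball x e" by (simp only: mem_ball dist_norm) (simp add: norm_minus_commute)
  then have "x + t *s ?v \<in> U" using e(2) by blast
  then show ?thesis using t(2) by blast
qed

lemma continuous_on_vector_line: "continuous_on A (\<lambda>t::complex. x + t *s (v :: complex^'n))"
  unfolding vector_scalar_mult_def by (intro continuous_intros)

text \<open>Two points of the set lie on a complex line from which only finitely many points have to
  be removed, and a real plane stays connected after the removal of a countable set.\<close>

lemma connected_polynomial_fn_nonzero:
  fixes p :: "complex^'n \<Rightarrow> complex"
  assumes "polynomial_fn p"
  shows "connected {z. p z \<noteq> 0}"
proof (subst connected_iff_connected_component, intro ballI)
  fix x y assume x: "x \<in> {z. p z \<noteq> 0}" and y: "y \<in> {z. p z \<noteq> 0}"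
  let ?l = "\<lambda>t. x + t *s (y - x)"
  let ?T = "- {t. p (?l t) = 0}"
  have fin: "finite {t. p (?l t) = 0}" using x by (intro finite_zeros_on_line[OF assms, where ?t0.0 = 0]) auto
  have "connected ?T"
    unfolding Compl_eq_Diff_UNIV
    by (intro connected_open_diff_countable countable_finite fin) auto
  then have "connected (?l ` ?T)"
    by (intro connected_continuous_image continuous_on_vector_line)
  moreover have "x \<in> ?l ` ?T" using x by (intro image_eqI[of _ _ 0]) auto
  moreover have "y \<in> ?l ` ?T" using y by (intro image_eqI[of _ _ 1]) auto
  ultimately show "connected_component {z. p z \<noteq> 0} x y"
    unfolding connected_component_def by (intro exI[of _ "?l ` ?T"]) auto
qed

subsection \<open>Monomials\<close>

definition monom_fn :: "('n \<Rightarrow> nat) \<Rightarrow> complex^'n \<Rightarrow> complex" where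
  "monom_fn \<alpha> z = (\<Prod>i\<in>UNIV. z $ i ^ \<alpha> i)"

lemma monom_fn_add: "monom_fn (\<lambda>i. \<alpha> i + \<beta> i) z = monom_fn \<alpha> z * monom_fn \<beta> z"
  by (simp add: monom_fn_def power_add prod.distrib)

lemma polynomial_fn_monom: "polynomial_fn (monom_fn \<alpha>)"
  unfolding monom_fn_def by (intro polynomial_fn_prod polynomial_fn_power polynomial_fn.coord)

abbreviation exponents :: "nat \<Rightarrow> ('n \<Rightarrow> nat) set" where
  "exponents d \<equiv> UNIV \<rightarrow>\<^sub>E {..d}"

lemma exponents_iff: "\<alpha> \<in> exponents d \<longleftrightarrow> (\<forall>i. \<alpha> i \<le> d)"
  by (simp add: PiE_iff)

text \<open>The exponent of each variable is bounded separately, so the admissible monomials form a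
  cube, whose size is a plain power and easy to compare. Since polynomials are functions here, the
  bound asserts that an expansion exists.\<close>

definition degree_le :: "nat \<Rightarrow> (complex^'n \<Rightarrow> complex) \<Rightarrow> bool" where
  "degree_le d p \<longleftrightarrow> (\<exists>c. \<forall>z. p z = (\<Sum>\<alpha>\<in>exponents d. c \<alpha> * monom_fn \<alpha> z))"

lemma finite_exponents: "finite (exponents d :: ('n::finite \<Rightarrow> nat) set)"
  by (intro finite_PiE) auto

lemma degree_le_monom:
  assumes "\<alpha> \<in> exponents d"
  shows "degree_le d (monom_fn \<alpha>)"
proof -
  have "monom_fn \<alpha> z = (\<Sum>\<beta>\<in>exponents d. (if \<beta> = \<alpha> then 1 else 0) * monom_fn \<beta> z)" for z
    using assms by (simp add: mult_delta_left finite_exponents)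
  then show ?thesis
    unfolding degree_le_def by (intro exI[of _ "\<lambda>\<beta>. if \<beta> = \<alpha> then 1 else 0"]) blast
qed

lemma degree_le_add:
  assumes "degree_le d p" "degree_le d q"
  shows "degree_le d (\<lambda>z. p z + q z)"
proof -
  obtain a b where "\<forall>z. p z = (\<Sum>\<alpha>\<in>exponents d. a \<alpha> * monom_fn \<alpha> z)"
    "\<forall>z. q z = (\<Sum>\<alpha>\<in>exponents d. b \<alpha> * monom_fn \<alpha> z)"
    using assms unfolding degree_le_def by blast
  then have "\<forall>z. p z + q z = (\<Sum>\<alpha>\<in>exponents d. (a \<alpha> + b \<alpha>) * monom_fn \<alpha> z)"
    by (simp add: sum.distrib algebra_simps)
  then show ?thesis unfolding degree_le_def by (rule exI[of _ "\<lambda>\<alpha>. a \<alpha> + b \<alpha>"])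
qed

lemma degree_le_cmult:
  assumes "degree_le d p"
  shows "degree_le d (\<lambda>z. c * p z)"
proof -
  obtain a where "\<forall>z. p z = (\<Sum>\<alpha>\<in>exponents d. a \<alpha> * monom_fn \<alpha> z)"
    using assms unfolding degree_le_def by blast
  then have "\<forall>z. c * p z = (\<Sum>\<alpha>\<in>exponents d. (c * a \<alpha>) * monom_fn \<alpha> z)"
    by (simp add: sum_distrib_left algebra_simps)
  then show ?thesis unfolding degree_le_def by (rule exI[of _ "\<lambda>\<alpha>. c * a \<alpha>"])
qed

lemma degree_le_const: "degree_le d (\<lambda>z. c)"
  proof -
  have "degree_le d (\<lambda>z. c * monom_fn (\<lambda>_. 0) z)"
    by (intro degree_le_cmult degree_le_monom) auto
  then show ?thesis by (simp add: monom_fn_def)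
qed

lemma degree_le_sum:
  "(\<And>x. x \<in> A \<Longrightarrow> degree_le d (f x)) \<Longrightarrow> degree_le d (\<lambda>z. \<Sum>x\<in>A. f x z)"
  by (induction A rule: infinite_finite_induct) (auto intro: degree_le_add degree_le_const)

lemma degree_le_mult:
  assumes "degree_le d p" "degree_le e q"
  shows "degree_le (d + e) (\<lambda>z. p z * q z)"
proof -
  obtain a b where a: "\<forall>z. p z = (\<Sum>\<alpha>\<in>exponents d. a \<alpha> * monom_fn \<alpha> z)"
    and b: "\<forall>z. q z = (\<Sum>\<beta>\<in>exponents e. b \<beta> * monom_fn \<beta> z)"
    using assms unfolding degree_le_def by blast
  have "degree_le (d + e) (\<lambda>z. \<Sum>\<alpha>\<in>exponents d. \<Sum>\<beta>\<in>exponents e. (a \<alpha> * b \<beta>) * monom_fn (\<lambda>i. \<alpha> i + \<beta> i) z)"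
    by (intro degree_le_sum degree_le_cmult degree_le_monom) (simp add: exponents_iff add_mono)
  moreover have "p z * q z = (\<Sum>\<alpha>\<in>exponents d. \<Sum>\<beta>\<in>exponents e. (a \<alpha> * b \<beta>) * monom_fn (\<lambda>i. \<alpha> i + \<beta> i) z)" for z
    unfolding a[rule_format] b[rule_format] sum_product monom_fn_add by (intro sum.cong refl) (simp only: mult_ac)
  ultimately show ?thesis by simp
qed

lemma degree_le_mono:
  assumes "degree_le d p" "d \<le> e"
  shows "degree_le e p"
  \<comment> \<open>The constant 1 is regarded as having degree \<open>e - d\<close>.\<close>
  using degree_le_mult[OF assms(1) degree_le_const[of "e - d" 1]] assms(2) by simp

lemma degree_le_coord: "degree_le 1 (\<lambda>z. z $ i)"
proof -
  have "monom_fn (\<lambda>j. if j = i then 1 else 0) z = z $ i" for z :: "complex^'a"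
    unfolding monom_fn_def by (simp add: if_distrib prod.delta cong: if_cong)
  moreover have "degree_le 1 (monom_fn (\<lambda>j. if j = i then 1 else 0))"
    by (intro degree_le_monom) auto
  ultimately show ?thesis by presburger
qed

lemma degree_le_power: "degree_le d p \<Longrightarrow> degree_le (k * d) (\<lambda>z. p z ^ k)"
  by (induction k) (simp_all add: degree_le_const degree_le_mult)

lemma degree_le_prod:
  "finite A \<Longrightarrow> (\<And>x. x \<in> A \<Longrightarrow> degree_le (d x) (f x)) \<Longrightarrow>
    degree_le (\<Sum>x\<in>A. d x) (\<lambda>z. \<Prod>x\<in>A. f x z)"
  by (induction A rule: finite_induct) (simp_all add: degree_le_const degree_le_mult)

lemma polynomial_fn_degree_le:
  assumes "polynomial_fn p"
  shows "\<exists>d. degree_le d p"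
  using assms
proof induction
  case (const c)
  show ?case using degree_le_const by (rule exI)
next
  case (coord i)
  show ?case using degree_le_coord by (rule exI)
next
  case (add p q)
  then obtain d e where d: "degree_le d p" "degree_le e q" by blast
  have "degree_le (max d e) (\<lambda>z. p z + q z)"
    by (intro degree_le_add degree_le_mono[OF d(1)] degree_le_mono[OF d(2)]) auto
  then show ?case by (rule exI)
next
  case (mult p q)
  then obtain d e where d: "degree_le d p" "degree_le e q" by blast
  show ?case using degree_le_mult[OF d] by (rule exI)
qed

text \<open>Induction on the set of variables: with the other variables fixed, the sum is a
  polynomial in the new one that vanishes identically, so each of its coefficients, a sum of the
  same kind in fewer variables, vanishes.\<close>

lemma monomials_independent_on:
  fixes c :: "('n \<Rightarrow> nat) \<Rightarrow> complex"
  assumes "finite I"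
    and "\<And>y. (\<Sum>\<alpha>\<in>I \<rightarrow>\<^sub>E {..d}. c \<alpha> * (\<Prod>i\<in>I. y i ^ \<alpha> i)) = 0"
    and "\<alpha> \<in> I \<rightarrow>\<^sub>E {..d}"
  shows "c \<alpha> = 0"
  using assms
proof (induction I arbitrary: c \<alpha> rule: finite_induct)
  case empty
  then show ?case by simp
next
  case (insert i I)
  have bij: "bij_betw (\<lambda>(k, \<beta>). \<beta>(i := k)) ({..d} \<times> (I \<rightarrow>\<^sub>E {..d})) (insert i I \<rightarrow>\<^sub>E {..d})"
    unfolding bij_betw_def PiE_insert_eq using inj_combinator[OF insert.hyps(2)] by (intro conjI refl)
  have *: "(\<Sum>\<beta>\<in>I \<rightarrow>\<^sub>E {..d}. c (\<beta>(i := k)) * (\<Prod>j\<in>I. y j ^ \<beta> j)) = 0" if "k \<le> d" for k y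
  proof -
    define Q where "Q k = (\<Sum>\<beta>\<in>I \<rightarrow>\<^sub>E {..d}. c (\<beta>(i := k)) * (\<Prod>j\<in>I. y j ^ \<beta> j))" for k
    have "(\<Sum>k\<le>d. Q k * t ^ k) = 0" for t
    proof -
      have upd: "(\<Prod>j\<in>insert i I. (y(i := t)) j ^ (\<beta>(i := k)) j) = t ^ k * (\<Prod>j\<in>I. y j ^ \<beta> j)"
        for \<beta> k
      proof -
        have "(\<Prod>j\<in>I. (y(i := t)) j ^ (\<beta>(i := k)) j) = (\<Prod>j\<in>I. y j ^ \<beta> j)"
          using insert.hyps by (intro prod.cong) auto
        then show ?thesis using insert.hyps by simp
      qed
      have "0 = (\<Sum>\<alpha>\<in>insert i I \<rightarrow>\<^sub>E {..d}. c \<alpha> * (\<Prod>j\<in>insert i I. (y(i := t)) j ^ \<alpha> j))"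
        using insert.prems(1) by simp
      also have "\<dots> = (\<Sum>x\<in>{..d} \<times> (I \<rightarrow>\<^sub>E {..d}).
          c ((\<lambda>(k, \<beta>). \<beta>(i := k)) x) *
            (\<Prod>j\<in>insert i I. (y(i := t)) j ^ ((\<lambda>(k, \<beta>). \<beta>(i := k)) x) j))"
        by (rule sum.reindex_bij_betw[OF bij, symmetric])
      also have "\<dots> = (\<Sum>(k, \<beta>)\<in>{..d} \<times> (I \<rightarrow>\<^sub>E {..d}).
          c (\<beta>(i := k)) * (\<Prod>j\<in>insert i I. (y(i := t)) j ^ (\<beta>(i := k)) j))"
        by (simp only: split_def)
      also have "\<dots> = (\<Sum>k\<le>d. \<Sum>\<beta>\<in>I \<rightarrow>\<^sub>E {..d}. c (\<beta>(i := k)) * (t ^ k * (\<Prod>j\<in>I. y j ^ \<beta> j)))"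
        by (simp only: upd sum.cartesian_product)
      also have "\<dots> = (\<Sum>k\<le>d. Q k * t ^ k)"
        unfolding Q_def sum_distrib_right by (intro sum.cong refl) (simp only: mult_ac)
      finally show ?thesis by simp
    qed
    then have "\<forall>k\<le>d. Q k = 0" by (intro polyfun_eq_0[THEN iffD1] allI)
    then show ?thesis using that by (simp add: Q_def)
  qed
  have "\<alpha> \<in> (\<lambda>(k, \<beta>). \<beta>(i := k)) ` ({..d} \<times> (I \<rightarrow>\<^sub>E {..d}))"
    using insert.prems(2) by (simp only: PiE_insert_eq)
  then obtain \<beta> k where \<alpha>: "\<alpha> = \<beta>(i := k)" "\<beta> \<in> I \<rightarrow>\<^sub>E {..d}" "k \<le> d"
    by (elim imageE) (simp add: split_def mem_Times_iff)
  show ?case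
    unfolding \<alpha>(1) by (rule insert.IH[of "\<lambda>\<beta>. c (\<beta>(i := k))", OF *[OF \<alpha>(3)] \<alpha>(2)])
qed

lemma monomials_independent:
  fixes c :: "('n::finite \<Rightarrow> nat) \<Rightarrow> complex"
  assumes "\<And>y::complex^'n. (\<Sum>\<alpha>\<in>exponents d. c \<alpha> * monom_fn \<alpha> y) = 0" "\<alpha> \<in> exponents d"
  shows "c \<alpha> = 0"
proof (rule monomials_independent_on[OF finite _ assms(2)])
  fix y :: "'n \<Rightarrow> complex"
  show "(\<Sum>\<alpha>\<in>exponents d. c \<alpha> * (\<Prod>i\<in>UNIV. y i ^ \<alpha> i)) = 0"
    using assms(1)[of "\<chi> i. y i"] by (simp add: monom_fn_def)
qed

section \<open>Elimination\<close>

text \<open>Gaussian elimination. The index sets are arbitrary because the unknowns will be indexed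
  by pairs of a multi-exponent and a power.\<close>

lemma underdetermined_system:
  fixes M :: "'a \<Rightarrow> 'b \<Rightarrow> complex"
  assumes "finite B" "finite A" "card B < card A"
  shows "\<exists>c. (\<exists>x\<in>A. c x \<noteq> 0) \<and> (\<forall>b\<in>B. (\<Sum>x\<in>A. c x * M x b) = 0)"
  using assms
proof (induction B arbitrary: A M rule: finite_induct)
  case empty
  then obtain x where "x \<in> A" by fastforce
  then show ?case by (intro exI[of _ "\<lambda>_. 1"]) auto
next
  case (insert \<beta> B)
  show ?case
  proof (cases "\<forall>x\<in>A. M x \<beta> = 0")
    case True
    have "card B < card A" using insert by simp
    from insert.IH[OF insert.prems(1) this, of M] True show ?thesis by auto
  next
    case False
    then obtain x0 where x0: "x0 \<in> A" "M x0 \<beta> \<noteq> 0" by blast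
    \<comment> \<open>\<open>N\<close> is what remains of the system once the equation
      \<open>\<beta>\<close> has been used to eliminate the unknown at \<open>x0\<close>.\<close>
    define N where "N x b = M x b - M x \<beta> / M x0 \<beta> * M x0 b" for x b
    have "card B < card (A - {x0})" using insert x0(1) by simp
    from insert.IH[OF _ this, of N] insert.prems(1)
    obtain c x1 where c: "x1 \<in> A - {x0}" "c x1 \<noteq> 0"
      "\<And>b. b \<in> B \<Longrightarrow> (\<Sum>x\<in>A - {x0}. c x * N x b) = 0" by auto
    \<comment> \<open>The equation \<open>\<beta>\<close> forces the value \<open>- s\<close> on the
      unknown at \<open>x0\<close>.\<close>
    define s where "s = (\<Sum>x\<in>A - {x0}. c x * M x \<beta>) / M x0 \<beta>"
    define c' where "c' = c(x0 := - s)"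
    have sum: "(\<Sum>x\<in>A. c' x * M x b) = (\<Sum>x\<in>A - {x0}. c x * M x b) - s * M x0 b" for b
    proof -
      have "(\<Sum>x\<in>A. c' x * M x b) = c' x0 * M x0 b + (\<Sum>x\<in>A - {x0}. c' x * M x b)"
        by (rule sum.remove[OF insert.prems(1) x0(1)])
      also have "(\<Sum>x\<in>A - {x0}. c' x * M x b) = (\<Sum>x\<in>A - {x0}. c x * M x b)"
        by (intro sum.cong) (auto simp: c'_def)
      finally show ?thesis by (simp add: c'_def)
    qed
    have "(\<Sum>x\<in>A. c' x * M x b) = 0" if "b \<in> insert \<beta> B" for b
    proof (cases "b = \<beta>")
      case True
      then show ?thesis unfolding sum using x0(2) by (simp add: s_def)
    next
      case False
      then have "0 = (\<Sum>x\<in>A - {x0}. c x * N x b)" using c(3) that by simp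
      also have "\<dots> = (\<Sum>x\<in>A - {x0}. c x * M x b) - s * M x0 b"
        unfolding N_def s_def right_diff_distrib sum_subtractf sum_divide_distrib sum_distrib_right
        by (intro arg_cong2[of _ _ _ _ minus] refl sum.cong) simp
      finally show ?thesis unfolding sum by simp
    qed
    moreover have "c' x1 \<noteq> 0" "x1 \<in> A" using c by (auto simp: c'_def)
    ultimately show ?thesis by blast
  qed
qed

text \<open>There are more monomials \<open>y\<^sup>\<alpha> t\<^sup>j\<close> of large degree than there are monomials in
  \<open>z\<close> of the degree reached by the substitution \<open>y = F z\<close>, \<open>t = q z\<close>.\<close>

lemma algebraic_relation:
  fixes F :: "complex^'n \<Rightarrow> complex^'n"
  assumes F: "\<And>i. polynomial_fn (\<lambda>z. F z $ i)" and q: "polynomial_fn q"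
  obtains L p where "\<And>j. polynomial_fn (p j)" "\<exists>j\<le>L. \<exists>y. p j y \<noteq> 0"
    "\<And>z. (\<Sum>j\<le>L. p j (F z) * q z ^ j) = 0"
proof -
  define n where "n = CARD('n)"
  from F have "\<forall>i. \<exists>d. degree_le d (\<lambda>z. F z $ i)" by (intro allI polynomial_fn_degree_le)
  then obtain d where d: "\<forall>i. degree_le (d i) (\<lambda>z. F z $ i)" by (rule choice[THEN exE])
  obtain e where e: "degree_le e q" using polynomial_fn_degree_le[OF q] by (rule exE)
  define D where "D = (\<Sum>i\<in>UNIV. d i) + e"
  have "d i \<le> D" for i
    unfolding D_def using member_le_sum[of i UNIV d] by simp
  then have FD: "degree_le D (\<lambda>z. F z $ i)" for i by (rule degree_le_mono[OF d[rule_format]])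
  have qD: "degree_le D q" by (rule degree_le_mono[OF e]) (simp add: D_def)
  \<comment> \<open>With \<open>K = (n + 1) * L * D\<close>, the number \<open>(K + 1) ^ n\<close>
    of monomials in \<open>z\<close> is at most \<open>(((n + 1) * D + 1) * (L + 1)) ^ n\<close>.
    This choice of \<open>L\<close> turns that bound into \<open>L * (L + 1) ^ n\<close>, which is
    less than the number \<open>(L + 1) * (L + 1) ^ n\<close> of products substituted.\<close>
  define L where "L = ((n + 1) * D + 1) ^ n"
  define K where "K = n * (L * D) + L * D"
  define A where "A = (exponents L :: ('n \<Rightarrow> nat) set) \<times> {..L}"
  define G where "G x z = monom_fn (fst x) (F z) * q z ^ snd x" for x z
  have "degree_le K (G x)" if "x \<in> A" for x
  proof -
    have le: "fst x i \<le> L" "snd x \<le> L" for i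
      using that by (simp_all add: A_def mem_Times_iff exponents_iff)
    have "degree_le (\<Sum>i\<in>(UNIV :: 'n set). fst x i * D) (\<lambda>z. monom_fn (fst x) (F z))"
      unfolding monom_fn_def by (intro degree_le_prod degree_le_power FD) simp
    moreover have "(\<Sum>i\<in>(UNIV :: 'n set). fst x i * D) \<le> (\<Sum>i\<in>(UNIV :: 'n set). L * D)"
      by (intro sum_mono mult_right_mono le) simp
    ultimately have "degree_le (n * (L * D)) (\<lambda>z. monom_fn (fst x) (F z))"
      by (elim degree_le_mono) (simp add: n_def)
    moreover have "degree_le (L * D) (\<lambda>z. q z ^ snd x)"
      by (rule degree_le_mono[OF degree_le_power[OF qD]]) (intro mult_right_mono le, simp)
    ultimately show ?thesis unfolding K_def G_def by (rule degree_le_mult)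
  qed
  then have "\<forall>x. \<exists>m. x \<in> A \<longrightarrow> (\<forall>z. G x z = (\<Sum>\<beta>\<in>exponents K. m \<beta> * monom_fn \<beta> z))"
    unfolding degree_le_def by blast
  then obtain M where M: "\<forall>x. x \<in> A \<longrightarrow> (\<forall>z. G x z = (\<Sum>\<beta>\<in>exponents K. M x \<beta> * monom_fn \<beta> z))"
    by (rule choice[THEN exE])
  have fin: "finite A" unfolding A_def by (intro finite_cartesian_product finite_exponents) simp
  have card_exp: "card (exponents k :: ('n \<Rightarrow> nat) set) = (k + 1) ^ n" for k
    by (simp add: card_funcsetE n_def)
  have "card (exponents K :: ('n \<Rightarrow> nat) set) < card A"
  proof -
    have "K + 1 \<le> ((n + 1) * D + 1) * (L + 1)" by (simp add: K_def algebra_simps)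
    then have "(K + 1) ^ n \<le> (((n + 1) * D + 1) * (L + 1)) ^ n" by (intro power_mono) auto
    also have "\<dots> = L * (L + 1) ^ n" by (simp only: L_def power_mult_distrib)
    also have "\<dots> < (L + 1) * (L + 1) ^ n" by (intro mult_strict_right_mono) auto
    finally show ?thesis unfolding A_def card_cartesian_product card_exp by (simp add: mult.commute)
  qed
  from underdetermined_system[OF finite_exponents fin this, of M]
  obtain c x0 where x0: "x0 \<in> A" "c x0 \<noteq> 0"
    and c: "\<forall>\<beta>\<in>exponents K. (\<Sum>x\<in>A. c x * M x \<beta>) = 0" by blast
  define p where "p j y = (\<Sum>\<alpha>\<in>exponents L. c (\<alpha>, j) * monom_fn \<alpha> y)" for j and y :: "complex^'n"
  show ?thesis
  proof
    fix j show "polynomial_fn (p j)"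
      unfolding p_def
      by (intro polynomial_fn_sum polynomial_fn.mult polynomial_fn.const polynomial_fn_monom)
  next
    have "\<exists>y. p (snd x0) y \<noteq> 0"
    proof (rule ccontr)
      assume "\<nexists>y. p (snd x0) y \<noteq> 0"
      then have "c (fst x0, snd x0) = 0"
        using x0(1) by (intro monomials_independent[where d = L and c = "\<lambda>\<alpha>. c (\<alpha>, snd x0)"])
          (simp_all add: p_def A_def mem_Times_iff)
      then show False using x0(2) by simp
    qed
    moreover have "snd x0 \<le> L" using x0(1) by (simp add: A_def mem_Times_iff)
    ultimately show "\<exists>j\<le>L. \<exists>y. p j y \<noteq> 0" by blast
  next
    fix z
    have "(\<Sum>j\<le>L. p j (F z) * q z ^ j) = (\<Sum>j\<le>L. \<Sum>\<alpha>\<in>exponents L. c (\<alpha>, j) * G (\<alpha>, j) z)"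
      by (simp add: p_def G_def sum_distrib_right mult.assoc)
    also have "\<dots> = (\<Sum>x\<in>A. c x * G x z)"
      unfolding A_def by (subst sum.swap) (simp add: sum.cartesian_product split_def)
    also have "\<dots> = (\<Sum>x\<in>A. \<Sum>\<beta>\<in>exponents K. monom_fn \<beta> z * (c x * M x \<beta>))"
      by (intro sum.cong refl) (simp only: M[rule_format] sum_distrib_left mult_ac)
    also have "\<dots> = (\<Sum>\<beta>\<in>exponents K. monom_fn \<beta> z * (\<Sum>x\<in>A. c x * M x \<beta>))"
      by (subst sum.swap) (simp add: sum_distrib_left)
    also have "\<dots> = 0" using c by simp
    finally show "(\<Sum>j\<le>L. p j (F z) * q z ^ j) = 0" .
  qed
qed

text \<open>If \<open>cmod t > 1\<close>, all powers of \<open>t\<close> up to the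
  \<open>m\<close>-th are bounded by \<open>cmod t ^ m\<close>, and division by this power bounds
  \<open>t\<close>. The summand 1 covers the other case.\<close>

lemma root_bound:
  fixes a :: "nat \<Rightarrow> complex"
  assumes "(\<Sum>j\<le>Suc m. a j * t ^ j) = 0" "a (Suc m) \<noteq> 0"
  shows "cmod t \<le> 1 + (\<Sum>j\<le>m. cmod (a j)) / cmod (a (Suc m))"
proof (cases "cmod t \<le> 1")
  case True
  then show ?thesis by (simp add: add_increasing2 sum_nonneg)
next
  case False
  then have t: "cmod t \<ge> 1" "cmod t > 0" by auto
  have "a (Suc m) * t ^ Suc m = - (\<Sum>j\<le>m. a j * t ^ j)"
    using assms(1) by (simp add: eq_neg_iff_add_eq_0 add.commute)
  then have "cmod (a (Suc m)) * cmod t ^ Suc m = cmod (\<Sum>j\<le>m. a j * t ^ j)"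
    by (metis norm_minus_cancel norm_mult norm_power)
  also have "\<dots> \<le> (\<Sum>j\<le>m. cmod (a j) * cmod t ^ m)"
    by (rule order_trans[OF norm_sum], rule sum_mono)
       (use t in \<open>simp add: norm_mult norm_power mult_left_mono power_increasing\<close>)
  finally have "(cmod (a (Suc m)) * cmod t) * cmod t ^ m \<le> (\<Sum>j\<le>m. cmod (a j)) * cmod t ^ m"
    unfolding sum_distrib_right[symmetric] power_Suc by (simp only: mult_ac)
  then have "cmod (a (Suc m)) * cmod t \<le> (\<Sum>j\<le>m. cmod (a j))"
    using t(2) by (simp add: mult_le_cancel_right)
  then have "cmod t \<le> (\<Sum>j\<le>m. cmod (a j)) / cmod (a (Suc m))"
    using assms(2) by (simp add: field_simps)
  then show ?thesis by simp
qed

text \<open>By \<open>algebraic_relation\<close>, \<open>q z\<close> is a root of a polynomial whose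
  coefficients are polynomials in \<open>F z\<close>. Where the leading one does not vanish, the
  roots are bounded continuously in \<open>F z\<close>. Applied to the coordinates of
  \<open>z\<close>, this makes \<open>F\<close> proper off a hypersurface.\<close>

lemma polynomial_map_generically_bounded:
  fixes F :: "complex^'n \<Rightarrow> complex^'n"
  assumes F: "\<And>i. polynomial_fn (\<lambda>z. F z $ i)" and q: "polynomial_fn q"
    and int: "interior (range F) \<noteq> {}"
  obtains a r where "polynomial_fn a" "\<exists>y. a y \<noteq> 0" "continuous_on {y. a y \<noteq> 0} r"
    "\<And>z. a (F z) \<noteq> 0 \<Longrightarrow> cmod (q z) \<le> r (F z)"
proof -
  obtain L p where p: "\<And>j. polynomial_fn (p j)" and nz: "\<exists>j\<le>L. \<exists>y. p j y \<noteq> 0"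
    and rel: "\<And>z. (\<Sum>j\<le>L. p j (F z) * q z ^ j) = 0"
    by (rule algebraic_relation[OF F q]) blast
  \<comment> \<open>\<open>L\<close> is only a formal degree: leading coefficients may vanish
    identically, so the true degree \<open>m\<close> is singled out.\<close>
  define J where "J = {j. j \<le> L \<and> (\<exists>y. p j y \<noteq> 0)}"
  have J: "finite J" "J \<noteq> {}" using nz by (auto simp: J_def)
  define m where "m = Max J"
  have mJ: "m \<in> J" unfolding m_def using J by (rule Max_in)
  have top: "p j y = 0" if "j \<le> L" "j > m" for j y
    using that Max_ge[OF J(1), of j] unfolding m_def[symmetric] by (auto simp: J_def)
  have rel': "(\<Sum>j\<le>m. p j (F z) * q z ^ j) = 0" for z
  proof -
    have "(\<Sum>j\<le>m. p j (F z) * q z ^ j) = (\<Sum>j\<le>L. p j (F z) * q z ^ j)"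
      using mJ by (intro sum.mono_neutral_left) (auto simp: J_def top)
    then show ?thesis using rel by simp
  qed
  obtain y0 where y0: "p m y0 \<noteq> 0" using mJ by (auto simp: J_def)
  show ?thesis
  proof (cases m)
    case 0
    \<comment> \<open>In degree 0 the relation says that \<open>p 0\<close> vanishes on the whole
      range, hence on an open set, which contradicts its being a nonzero polynomial.\<close>
    obtain x where "x \<in> interior (range F)" using int by blast
    then obtain y where "y \<in> interior (range F)" "p m y \<noteq> 0"
      using polynomial_fn_nonzero_near[OF p y0 open_interior] by blast
    moreover then obtain z where "y = F z" using interior_subset by blast
    ultimately have False using rel'[of z] 0 by simp
    then show ?thesis ..
  next
    case (Suc k)
    show ?thesis
    proof (rule that[of "p m" "\<lambda>y. 1 + (\<Sum>j\<le>k. cmod (p j y)) / cmod (p m y)"])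
      show "polynomial_fn (p m)" by (rule p)
      show "\<exists>y. p m y \<noteq> 0" using y0 by blast
      show "continuous_on {y. p m y \<noteq> 0} (\<lambda>y. 1 + (\<Sum>j\<le>k. cmod (p j y)) / cmod (p m y))"
        by (intro continuous_intros continuous_on_polynomial_fn p) auto
      fix z assume "p m (F z) \<noteq> 0"
      then show "cmod (q z) \<le> 1 + (\<Sum>j\<le>k. cmod (p j (F z))) / cmod (p m (F z))"
        using rel'[of z] unfolding Suc by (intro root_bound)
    qed
  qed
qed

section \<open>Nonvanishing sets of polynomials and images of hypersurfaces\<close>

lemma polynomial_fn_eq_0I:
  assumes "polynomial_fn p" "open U" "U \<noteq> {}" "\<And>x. x \<in> U \<Longrightarrow> p x = 0"
  shows "p y = 0"
  using polynomial_fn_nonzero_near[OF assms(1) _ assms(2)] assms(3,4) by blast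

lemma open_polynomial_fn_nonzero: "polynomial_fn p \<Longrightarrow> open {z. p z \<noteq> 0}"
  by (intro open_Collect_neq continuous_on_polynomial_fn continuous_on_const)

lemma polynomial_fn_nonzero_mult:
  assumes "polynomial_fn p" "polynomial_fn q" "\<exists>x. p x \<noteq> 0" "\<exists>x. q x \<noteq> 0"
  shows "\<exists>x. p x * q x \<noteq> 0"
proof -
  obtain x y where "p x \<noteq> 0" "q y \<noteq> 0" using assms(3,4) by blast
  then show ?thesis
    using polynomial_fn_nonzero_near[OF assms(2) _ open_polynomial_fn_nonzero[OF assms(1)], of y x] by auto
qed

lemma polynomial_fn_nonzero_prod:
  "finite A \<Longrightarrow> (\<And>i. i \<in> A \<Longrightarrow> polynomial_fn (f i)) \<Longrightarrow> (\<And>i. i \<in> A \<Longrightarrow> \<exists>x. f i x \<noteq> 0) \<Longrightarrow>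
    \<exists>x. (\<Prod>i\<in>A. f i x) \<noteq> 0"
proof (induction A rule: finite_induct)
  case (insert i A)
  have "\<exists>x. f i x * (\<Prod>i\<in>A. f i x) \<noteq> 0"
    using insert by (intro polynomial_fn_nonzero_mult polynomial_fn_prod) auto
  then show ?case using insert by simp
qed auto

text \<open>Once the highest common power of \<open>q\<close> is cancelled from an algebraic
  relation, its lowest coefficient must vanish at \<open>F z\<close> whenever
  \<open>q z = 0\<close>. With the Jacobian determinant as \<open>q\<close>, this puts the critical
  values into a hypersurface.\<close>

lemma polynomial_zero_image:
  fixes F :: "complex^'n \<Rightarrow> complex^'n"
  assumes F: "\<And>i. polynomial_fn (\<lambda>z. F z $ i)" and q: "polynomial_fn q" "\<exists>z. q z \<noteq> 0"
  obtains b where "polynomial_fn b" "\<exists>y. b y \<noteq> 0" "\<And>z. b (F z) \<noteq> 0 \<Longrightarrow> q z \<noteq> 0"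
proof -
  obtain L p where p: "\<And>j. polynomial_fn (p j)" and nz: "\<exists>j\<le>L. \<exists>y. p j y \<noteq> 0"
    and rel: "\<And>z. (\<Sum>j\<le>L. p j (F z) * q z ^ j) = 0"
    by (rule algebraic_relation[OF F q(1)]) blast
  define k where "k = (LEAST j. j \<le> L \<and> (\<exists>y. p j y \<noteq> 0))"
  have k: "k \<le> L" "\<exists>y. p k y \<noteq> 0"
    using LeastI_ex[of "\<lambda>j. j \<le> L \<and> (\<exists>y. p j y \<noteq> 0)"] nz unfolding k_def by auto
  have low: "p j y = 0" if "j < k" for j y
    using not_less_Least[of j "\<lambda>j. j \<le> L \<and> (\<exists>y. p j y \<noteq> 0)"] that k(1) unfolding k_def by auto
  define R where "R z = (\<Sum>j\<in>{k..L}. p j (F z) * q z ^ (j - k))" for z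
  have R: "polynomial_fn R"
    unfolding R_def
    by (intro polynomial_fn_sum polynomial_fn.mult polynomial_fn_power q polynomial_fn_compose[OF p F])
  have qR: "R z = 0" if "q z \<noteq> 0" for z
  proof -
    have "q z ^ k * R z = (\<Sum>j\<in>{k..L}. p j (F z) * q z ^ j)"
      unfolding R_def sum_distrib_left
      by (intro sum.cong refl) (simp add: mult.left_commute flip: power_add)
    also have "\<dots> = (\<Sum>j\<le>L. p j (F z) * q z ^ j)"
      by (intro sum.mono_neutral_left) (auto simp: low)
    finally show ?thesis using rel that by simp
  qed
  \<comment> \<open>Cancelling \<open>q z ^ k\<close> is legitimate only where \<open>q\<close> does
    not vanish; as that set is open and nonempty, the polynomial \<open>R\<close> vanishes
    everywhere, including at the zeros of \<open>q\<close>.\<close>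
  have R0: "R z = 0" for z
    by (rule polynomial_fn_eq_0I[OF R open_polynomial_fn_nonzero[OF q(1)]]) (use q(2) qR in auto)
  show ?thesis
  proof (rule that[OF p k(2)])
    fix z assume b: "p k (F z) \<noteq> 0"
    show "q z \<noteq> 0"
    proof
      assume q0: "q z = 0"
      have "R z = (\<Sum>j\<in>{k..L}. if j = k then p k (F z) else 0)"
        unfolding R_def by (intro sum.cong refl) (auto simp: q0)
      then show False using R0[of z] b k(1) by simp
    qed
  qed
qed

section \<open>The range of a polynomial map\<close>

lemma norm_le_sum_cmod: "norm (z :: complex^'n) \<le> (\<Sum>i\<in>UNIV. cmod (z $ i))"
  unfolding norm_vec_def by (rule L2_set_le_sum) simp

lemma continuous_on_polynomial_map:
  fixes F :: "complex^'n \<Rightarrow> complex^'k"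
  assumes "\<And>i. polynomial_fn (\<lambda>z. F z $ i)"
  shows "continuous_on A F"
  using continuous_on_vec_lambda[of A "\<lambda>i z. F z $ i"] continuous_on_polynomial_fn[OF assms]
  by simp

lemma polynomial_map_jacobian:
  fixes F :: "complex^'n \<Rightarrow> complex^'k"
  assumes "\<And>i. polynomial_fn (\<lambda>z. F z $ i)"
  obtains J where "\<And>i j. polynomial_fn (\<lambda>z. J z $ i $ j)"
    "\<And>z. (F has_derivative (\<lambda>h. J z *v h)) (at z)"
proof -
  have "\<forall>i. \<exists>D. (\<forall>j. polynomial_fn (D j)) \<and>
          (\<forall>z. ((\<lambda>z. F z $ i) has_derivative (\<lambda>h. \<Sum>j\<in>UNIV. D j z * h $ j)) (at z))"
    by (intro allI polynomial_fn_has_gradient assms)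
  then obtain D where D: "\<forall>i. (\<forall>j. polynomial_fn (D i j)) \<and>
      (\<forall>z. ((\<lambda>z. F z $ i) has_derivative (\<lambda>h. \<Sum>j\<in>UNIV. D i j z * h $ j)) (at z))"
    by (rule choice[THEN exE])
  define J where "J z = (\<chi> i j. D i j z)" for z
  show ?thesis
  proof
    fix i j show "polynomial_fn (\<lambda>z. J z $ i $ j)"
      unfolding J_def vec_lambda_beta using D by blast
  next
    fix z
    show "(F has_derivative (\<lambda>h. J z *v h)) (at z)"
    proof (subst has_derivative_componentwise_within, intro ballI)
      fix b :: "complex^'k" assume "b \<in> Basis"
      then obtain i c where b: "b = axis i c" by (auto simp: Basis_vec_def)
      have "((\<lambda>z. F z $ i \<bullet> c) has_derivative (\<lambda>h. (\<Sum>j\<in>UNIV. D i j z * h $ j) \<bullet> c)) (at z)"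
        using D by (intro has_derivative_inner_left) blast
      then show "((\<lambda>x. F x \<bullet> b) has_derivative (\<lambda>x. (J z *v x) \<bullet> b)) (at z)"
        by (simp add: b inner_axis J_def matrix_vector_mult_def)
    qed
  qed
qed

lemma interior_range_polynomial_map:
  fixes F :: "complex^'n \<Rightarrow> complex^'n"
  assumes F: "\<And>i. polynomial_fn (\<lambda>z. F z $ i)"
    and der: "(F has_derivative (\<lambda>h. J *v h)) (at z)" and "det J \<noteq> 0"
  shows "F z \<in> interior (range F)"
proof -
  have "invertible J" using assms(3) by (simp add: invertible_det_nz)
  then obtain B where "J ** B = mat 1" unfolding invertible_def by blast
  then have "(\<lambda>h. J *v h) \<circ> (\<lambda>h. B *v h) = id"
    by (auto simp: fun_eq_iff matrix_vector_mul_assoc)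
  then show ?thesis
    by (rule sussmann_open_mapping[OF open_UNIV continuous_on_polynomial_map[OF F] UNIV_I der
          matrix_vector_mul_bounded_linear _ subset_UNIV]) simp
qed

text \<open>The coordinate bounds are continuous on the compact set, hence bounded there, so the
  preimage is bounded as well as closed. This is the form in which properness is used.\<close>

lemma compact_polynomial_map_preimage:
  fixes F :: "complex^'n \<Rightarrow> complex^'k"
  assumes F: "\<And>i. polynomial_fn (\<lambda>z. F z $ i)" and K: "compact K"
    and r: "\<And>i. continuous_on K (r i)" "\<And>i z. F z \<in> K \<Longrightarrow> cmod (z $ i) \<le> r i (F z)"
  shows "compact (F -` K)"
proof -
  have "\<exists>B. \<forall>y\<in>K. r i y \<le> B" for i
  proof (cases "K = {}")
    case False
    then show ?thesis using continuous_attains_sup[OF K False r(1)] by blast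
  qed auto
  then have "\<forall>i. \<exists>B. \<forall>y\<in>K. r i y \<le> B" by blast
  then obtain B where B: "\<forall>i. \<forall>y\<in>K. r i y \<le> B i" by (rule choice[THEN exE])
  have "norm z \<le> (\<Sum>i\<in>UNIV. B i)" if "z \<in> F -` K" for z
  proof (intro order_trans[OF norm_le_sum_cmod] sum_mono)
    fix i
    have "F z \<in> K" using that by simp
    then show "cmod (z $ i) \<le> B i" using r(2)[of z i] B by (meson order_trans)
  qed
  then have "bounded (F -` K)" by (rule boundedI)
  moreover have "closed (F -` K)"
    by (rule continuous_closed_vimage[OF compact_imp_closed[OF K]])
       (use continuous_on_polynomial_map[OF F, of UNIV] in \<open>simp add: continuous_on_eq_continuous_at\<close>)
  ultimately show ?thesis by (simp add: compact_eq_bounded_closed)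
qed

text \<open>Off a hypersurface the map is proper and has no critical values, so that its range is both
  closed and open in the complement of that hypersurface, which is connected.\<close>

theorem polynomial_map_dominant:
  fixes F :: "complex^'n \<Rightarrow> complex^'n"
  assumes F: "\<And>i. polynomial_fn (\<lambda>z. F z $ i)"
    and der: "(F has_derivative D) (at z0)" and inj: "inj D"
  obtains a where "polynomial_fn a" "\<exists>y. a y \<noteq> 0" "{y. a y \<noteq> 0} \<subseteq> range F"
proof -
  obtain J where J: "\<And>i j. polynomial_fn (\<lambda>z. J z $ i $ j)"
    and derJ: "\<And>z. (F has_derivative (\<lambda>h. J z *v h)) (at z)"
    using polynomial_map_jacobian[OF F] by blast
  have "D = (\<lambda>h. J z0 *v h)" by (rule has_derivative_unique[OF der derJ])
  then have J0: "det (J z0) \<noteq> 0"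
    using inj matrix_left_invertible_injective[of "J z0"] invertible_left_inverse[of "J z0"]
    by (simp add: invertible_det_nz)
  have reg: "F z \<in> interior (range F)" if "det (J z) \<noteq> 0" for z
    by (rule interior_range_polynomial_map[OF F derJ that])
  have int: "interior (range F) \<noteq> {}" using reg[OF J0] by blast
  have "\<exists>z. det (J z) \<noteq> 0" using J0 by blast
  then obtain b where b: "polynomial_fn b" "\<exists>y. b y \<noteq> 0" "\<And>z. b (F z) \<noteq> 0 \<Longrightarrow> det (J z) \<noteq> 0"
    by (rule polynomial_zero_image[OF F polynomial_fn_det[OF J]]) blast
  have "\<exists>a r. polynomial_fn a \<and> (\<exists>y. a y \<noteq> 0) \<and> continuous_on {y. a y \<noteq> 0} r \<and>
          (\<forall>z. a (F z) \<noteq> 0 \<longrightarrow> cmod (z $ i) \<le> r (F z))" for i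
    by (rule polynomial_map_generically_bounded[OF F polynomial_fn.coord int, of i]) blast
  then have "\<forall>i. \<exists>ar. polynomial_fn (fst ar) \<and> (\<exists>y. fst ar y \<noteq> 0) \<and>
        continuous_on {y. fst ar y \<noteq> 0} (snd ar) \<and>
        (\<forall>z. fst ar (F z) \<noteq> 0 \<longrightarrow> cmod (z $ i) \<le> snd ar (F z))" by simp
  then obtain ar where ar: "\<forall>i. polynomial_fn (fst (ar i)) \<and> (\<exists>y. fst (ar i) y \<noteq> 0) \<and>
        continuous_on {y. fst (ar i) y \<noteq> 0} (snd (ar i)) \<and>
        (\<forall>z. fst (ar i) (F z) \<noteq> 0 \<longrightarrow> cmod (z $ i) \<le> snd (ar i) (F z))"
    by (rule choice[THEN exE])
  note ar1 = ar[rule_format, THEN conjunct1]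
    and ar2 = ar[rule_format, THEN conjunct2, THEN conjunct1]
    and ar3 = ar[rule_format, THEN conjunct2, THEN conjunct2, THEN conjunct1]
    and ar4 = ar[THEN spec, THEN conjunct2, THEN conjunct2, THEN conjunct2, rule_format]
  \<comment> \<open>Over a point where \<open>c\<close> does not vanish, \<open>b\<close> excludes
    critical points and the other factors bound every coordinate of a preimage.\<close>
  define c where "c y = b y * (\<Prod>i\<in>UNIV. fst (ar i) y)" for y
  have c: "polynomial_fn c"
    unfolding c_def by (intro polynomial_fn.mult b polynomial_fn_prod ar1)
  have c0: "\<exists>y. c y \<noteq> 0"
    unfolding c_def
    by (intro polynomial_fn_nonzero_mult b polynomial_fn_prod polynomial_fn_nonzero_prod ar1 ar2 finite)
  have cD: "b y \<noteq> 0" "fst (ar i) y \<noteq> 0" if "c y \<noteq> 0" for y i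
    using that by (auto simp: c_def)
  define W where "W = {y. c y \<noteq> 0}"
  have W: "open W" "connected W"
    unfolding W_def by (intro open_polynomial_fn_nonzero connected_polynomial_fn_nonzero c)+
  \<comment> \<open>Points of the range close to \<open>y\<close> come from the preimage of one
    closed ball. This preimage is compact because the coordinate bounds are continuous on the ball,
    so its image is closed and contains \<open>y\<close>.\<close>
  have cl: "y \<in> range F" if yW: "y \<in> W" and ycl: "y \<in> closure (range F)" for y
  proof -
    obtain e where e: "e > 0" "cball y e \<subseteq> W" using W(1) yW open_contains_cball by blast
    have "compact (F -` cball y e)"
    proof (rule compact_polynomial_map_preimage[where r = "\<lambda>i. snd (ar i)", OF F compact_cball])
      fix i
      show "continuous_on (cball y e) (snd (ar i))"
        by (rule continuous_on_subset[OF ar3]) (use e(2) cD in \<open>auto simp: W_def\<close>)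
    next
      fix i z assume "F z \<in> cball y e"
      then have "c (F z) \<noteq> 0" using e(2) by (auto simp: W_def)
      then show "cmod (z $ i) \<le> snd (ar i) (F z)" by (intro ar4 cD(2))
    qed
    then have "compact (F ` (F -` cball y e))"
      by (intro compact_continuous_image continuous_on_polynomial_map F)
    then have clo: "closed (F ` (F -` cball y e))" by (rule compact_imp_closed)
    have "y \<in> closure (F ` (F -` cball y e))"
      unfolding closure_approachable
    proof (intro allI impI)
      fix d :: real assume "d > 0"
      then have "min d e > 0" using e(1) by simp
      then obtain x where x: "x \<in> range F" "dist x y < min d e"
        using ycl unfolding closure_approachable by blast
      then show "\<exists>x\<in>F ` (F -` cball y e). dist x y < d"
        by (intro bexI[of _ x]) (auto simp: dist_commute)
    qed
    then show ?thesis using clo by (auto simp: closure_closed)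
  qed
  have cover: "W \<subseteq> interior (range F) \<union> - closure (range F)"
  proof
    fix y assume y: "y \<in> W"
    show "y \<in> interior (range F) \<union> - closure (range F)"
    proof (cases "y \<in> closure (range F)")
      case True
      then obtain z where z: "y = F z" using cl[OF y] by blast
      then have "det (J z) \<noteq> 0" using b(3) y cD(1) by (auto simp: W_def)
      then show ?thesis using reg z by simp
    qed simp
  qed
  have "interior (range F) \<inter> - closure (range F) \<inter> W = {}"
    using interior_subset closure_subset by blast
  then have "interior (range F) \<inter> W = {} \<or> - closure (range F) \<inter> W = {}"
    using connectedD[OF W(2) open_interior open_Compl[OF closed_closure] _ cover] by blast
  \<comment> \<open>The interior point \<open>F z0\<close> may itself lie on the hypersurface, but
    some interior point near it does not.\<close>
  moreover have "interior (range F) \<inter> W \<noteq> {}"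
  proof -
    obtain y1 where "c y1 \<noteq> 0" using c0 by blast
    from polynomial_fn_nonzero_near[OF c this open_interior reg[OF J0]]
    show ?thesis unfolding W_def by blast
  qed
  ultimately have "W \<subseteq> range F" using cl by blast
  then show ?thesis using that[OF c c0] unfolding W_def by blast
qed

section \<open>Complex matrices\<close>

lemma bounded_bilinear_matrix_mult:
  "bounded_bilinear ((**) :: complex^'m^'m \<Rightarrow> complex^'m^'m \<Rightarrow> complex^'m^'m)"
proof -
  have "bilinear ((**) :: complex^'m^'m \<Rightarrow> complex^'m^'m \<Rightarrow> complex^'m^'m)"
    unfolding bilinear_def
    by (auto intro!: linearI simp: matrix_add_ldistrib matrix_matrix_mult_def vec_eq_iff
        sum.distrib algebra_simps scaleR_sum_right)
  then show ?thesis by (simp add: bilinear_conv_bounded_bilinear)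
qed

interpretation matrix_mult: bounded_bilinear "(**) :: complex^'m^'m \<Rightarrow> complex^'m^'m \<Rightarrow> complex^'m^'m"
  by (rule bounded_bilinear_matrix_mult)

lemma cscale_mult_left: "cscale c X ** Y = cscale c (X ** Y)"
  by (simp add: cscale_def matrix_matrix_mult_def vec_eq_iff sum_distrib_left mult.assoc)

lemma cscale_mult_right: "X ** cscale c Y = cscale c (X ** Y)"
  by (simp add: cscale_def matrix_matrix_mult_def vec_eq_iff sum_distrib_left mult.left_commute)

lemma cscale_cscale: "cscale c (cscale d X) = cscale (c * d) X"
  by (simp add: cscale_def vec_eq_iff)

lemma cscale_1 [simp]: "cscale 1 X = X"
  by (simp add: cscale_def vec_eq_iff)

lemma cscale_0 [simp]: "cscale 0 X = 0"
  by (simp add: cscale_def vec_eq_iff)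

lemma cscale_zero_right [simp]: "cscale c 0 = 0"
  by (simp add: cscale_def vec_eq_iff)

lemma cscale_add_left: "cscale (c + d) X = cscale c X + cscale d X"
  by (simp add: cscale_def vec_eq_iff distrib_right)

lemma cscale_add_right: "cscale c (X + Y) = cscale c X + cscale c Y"
  by (simp add: cscale_def vec_eq_iff distrib_left)

lemma cscale_of_real: "cscale (of_real r) X = r *\<^sub>R X"
  by (simp add: cscale_def vec_eq_iff scaleR_conv_of_real[symmetric] complex_eq_iff)

lemma norm_cscale: "norm (cscale c X) = cmod c * norm X"
  by (simp add: cscale_def norm_vec_def norm_mult L2_set_right_distrib)

lemma bounded_linear_cscale: "bounded_linear (cscale c)"
  by (rule bounded_linear_intro[where K = "cmod c"])
     (simp_all add: cscale_add_right norm_cscale mult.commute, simp add: cscale_def vec_eq_iff)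

lemma bounded_linear_cscale_left: "bounded_linear (\<lambda>c. cscale c X)"
  by (rule bounded_linear_intro[where K = "norm X"])
     (simp_all add: cscale_add_left norm_cscale, simp add: cscale_def vec_eq_iff)

lemma trace_cscale: "trace (cscale c X) = c * trace X"
  by (simp add: trace_def cscale_def sum_distrib_left)

lemma matrix_inv_eqI:
  fixes A B :: "complex^'m^'m"
  assumes "A ** B = mat 1"
  shows "matrix_inv A = B"
proof -
  have BA: "B ** A = mat 1" using assms matrix_left_right_inverse by blast
  have "A ** matrix_inv A = mat 1 \<and> matrix_inv A ** A = mat 1"
    unfolding matrix_inv_def by (rule someI[of _ B]) (use assms BA in simp)
  then have "B ** (A ** matrix_inv A) = B" by simp
  then show ?thesis by (simp add: matrix_mul_assoc BA)
qed

lemma det_nonzero_inverse: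
  fixes A :: "complex^'m^'m"
  assumes "det A \<noteq> 0"
  shows "A ** matrix_inv A = mat 1" "matrix_inv A ** A = mat 1"
proof -
  have "invertible A" using assms by (simp add: invertible_det_nz)
  then show "A ** matrix_inv A = mat 1" "matrix_inv A ** A = mat 1"
    unfolding invertible_def matrix_inv_def by (rule someI2_ex; simp)+
qed

lemma det_matrix_inv:
  fixes A :: "complex^'m^'m"
  assumes "det A = 1"
  shows "det (matrix_inv A) = 1"
  using det_mul[of A "matrix_inv A"] det_nonzero_inverse(1)[of A] assms by simp

lemma trace_conjugate:
  fixes A :: "complex^'m^'m"
  assumes "det A \<noteq> 0"
  shows "trace (A ** X ** matrix_inv A) = trace X"
  using det_nonzero_inverse[OF assms] by (metis trace_mul_sym matrix_mul_assoc matrix_mul_lid)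

section \<open>The adjoint action has no proper invariant subspaces\<close>

definition matrix_unit :: "'m \<Rightarrow> 'm \<Rightarrow> complex^'m^'m" where
  "matrix_unit i j = (\<chi> a b. if a = i \<and> b = j then 1 else 0)"

lemma matrix_unit_nth: "matrix_unit i j $ a $ b = (if a = i \<and> b = j then 1 else 0)"
  by (simp add: matrix_unit_def)

lemma matrix_unit_mult_left_nth: "(matrix_unit i j ** X) $ a $ b = (if a = i then X $ j $ b else 0)"
  by (cases "a = i") (simp_all add: matrix_matrix_mult_def matrix_unit_nth mult_delta_left)

lemma matrix_unit_mult_right_nth: "(X ** matrix_unit i j) $ a $ b = (if b = j then X $ a $ i else 0)"
  by (cases "b = j") (simp_all add: matrix_matrix_mult_def matrix_unit_nth mult_delta_right)

lemma matrix_unit_mult: "matrix_unit i j ** matrix_unit k l = (if j = k then matrix_unit i l else 0)"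
  by (simp add: vec_eq_iff matrix_unit_mult_left_nth matrix_unit_nth)

lemma matrix_unit_sandwich:
  "matrix_unit i j ** X ** matrix_unit k l = cscale (X $ j $ k) (matrix_unit i l)"
  by (simp add: vec_eq_iff matrix_unit_mult_left_nth matrix_unit_mult_right_nth matrix_unit_nth cscale_def)

lemma transvection_inverse:
  assumes "i \<noteq> j"
  shows "(mat 1 + matrix_unit i j) ** (mat 1 - matrix_unit i j) = mat 1"
  using assms by (simp add: matrix_mult.add_left matrix_mult.diff_right matrix_unit_mult)

lemma det_transvection:
  fixes i j :: "'m::finite"
  assumes "i \<noteq> j"
  shows "det (mat 1 + matrix_unit i j) = 1"
proof -
  have "mat 1 + matrix_unit i j =
      (\<chi> k. if k = i then row i (mat 1) + 1 *s row j (mat 1) else row k (mat 1 :: complex^'m^'m))"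
    using assms by (auto simp: vec_eq_iff matrix_unit_nth row_def mat_def)
  then show ?thesis using det_row_operation[OF assms, of "mat 1" 1] by simp
qed

text \<open>For an off-diagonal matrix unit \<open>e\<close>, conjugation of \<open>Y\<close> by
  \<open>mat 1 + e\<close> and by \<open>mat 1 - e\<close> gives two elements of \<open>V\<close>
  whose difference is twice the commutator of \<open>e\<close> and \<open>Y\<close>, and whose sum
  differs from \<open>Y + Y\<close> by twice \<open>e ** Y ** e\<close>. Both operations isolate
  entries of \<open>Y\<close>, so \<open>V\<close> contains an off-diagonal matrix unit. Applied
  again, they produce all the others and the differences of diagonal units.\<close>

lemma Ad_invariant_subspace:
  fixes V :: "(complex^'m^'m) set"
  assumes V: "subspace V" and cV: "\<And>c X. X \<in> V \<Longrightarrow> cscale c X \<in> V"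
    and Ad: "\<And>A X. det A = 1 \<Longrightarrow> X \<in> V \<Longrightarrow> A ** X ** matrix_inv A \<in> V"
    and X: "X \<in> V" "X \<in> sl" "X \<noteq> 0"
  shows "sl \<subseteq> V"
proof -
  have half: "Y \<in> V" if "Y + Y \<in> V" for Y
    using subspace_scale[OF V that, of "1/2"] by (simp add: scaleR_2[symmetric])
  have conj: "Y + e ** Y - Y ** e - e ** Y ** e \<in> V" "Y - e ** Y + Y ** e - e ** Y ** e \<in> V"
    if Y: "Y \<in> V" and "i \<noteq> j" and e: "e = matrix_unit i j" for Y e i j
  proof -
    have "(mat 1 + e) ** Y ** (mat 1 - e) \<in> V"
      using Ad[OF det_transvection[OF \<open>i \<noteq> j\<close>] Y] matrix_inv_eqI[OF transvection_inverse[OF \<open>i \<noteq> j\<close>]]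
      by (simp add: e)
    then show "Y + e ** Y - Y ** e - e ** Y ** e \<in> V"
      by (simp add: matrix_mult.add_left matrix_mult.diff_right diff_diff_eq)
    have inv: "matrix_inv (mat 1 - e) = mat 1 + e"
      using transvection_inverse[OF \<open>i \<noteq> j\<close>] matrix_left_right_inverse unfolding e
      by (intro matrix_inv_eqI) blast
    have "det (mat 1 - e) = 1"
      using det_mul[of "mat 1 + e" "mat 1 - e"] transvection_inverse[OF \<open>i \<noteq> j\<close>]
        det_transvection[OF \<open>i \<noteq> j\<close>] by (simp add: e)
    from Ad[OF this Y] have "(mat 1 - e) ** Y ** (mat 1 + e) \<in> V" by (simp add: inv)
    then show "Y - e ** Y + Y ** e - e ** Y ** e \<in> V"
      by (simp add: matrix_mult.add_right matrix_mult.diff_left add_diff_eq)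
  qed
  have comm: "matrix_unit i j ** Y - Y ** matrix_unit i j \<in> V" if "Y \<in> V" "i \<noteq> j" for Y i j
  proof -
    have eq: "(Y + a - b - c) - (Y - a + b - c) = (a - b) + (a - b)" for a b c
      by simp
    from subspace_diff[OF V conj[OF that refl]] show ?thesis unfolding eq by (rule half)
  qed
  have sandwich: "cscale (Y $ j $ i) (matrix_unit i j) \<in> V" if "Y \<in> V" "i \<noteq> j" for Y i j
  proof -
    let ?e = "matrix_unit i j"
    have eq: "(Y + Y) - ((Y + a - b - c) + (Y - a + b - c)) = c + c" for a b c
      by simp
    have "(Y + Y) - ((Y + ?e ** Y - Y ** ?e - ?e ** Y ** ?e) + (Y - ?e ** Y + Y ** ?e - ?e ** Y ** ?e)) \<in> V"
      by (rule subspace_diff[OF V subspace_add[OF V that(1) that(1)] subspace_add[OF V conj[OF that refl]]])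
    then have "?e ** Y ** ?e \<in> V" unfolding eq by (rule half)
    then show ?thesis by (simp add: matrix_unit_sandwich)
  qed
  have unscale: "M \<in> V" if "cscale c M \<in> V" "c \<noteq> 0" for c M
    using cV[OF that(1), of "inverse c"] that(2) by (simp add: cscale_cscale)
  have "\<exists>i j. i \<noteq> j \<and> matrix_unit i j \<in> V"
  proof (cases "\<exists>i j. i \<noteq> j \<and> X $ j $ i \<noteq> 0")
    case True
    then obtain i j where ij: "i \<noteq> j" "X $ j $ i \<noteq> 0" by blast
    show ?thesis using ij(1) unscale[OF sandwich[OF X(1) ij(1)] ij(2)] by blast
  next
    case False
    then have diag: "X $ i $ j = 0" if "i \<noteq> j" for i j
      using that by (metis (no_types))
    \<comment> \<open>A diagonal matrix with equal entries and trace 0 is 0. For two different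
      diagonal entries, the commutator with the corresponding matrix unit is a nonzero multiple of
      that unit.\<close>
    have "\<exists>i j. X $ i $ i \<noteq> X $ j $ j"
    proof (rule ccontr)
      assume "\<nexists>i j. X $ i $ i \<noteq> X $ j $ j"
      then have eq: "X $ i $ i = X $ j $ j" for i j by blast
      fix k :: 'm
      have "trace X = (\<Sum>i\<in>(UNIV :: 'm set). X $ k $ k)"
        unfolding trace_def by (intro sum.cong refl eq)
      then have "X $ k $ k = 0" using X(2) by (simp add: sl_def)
      then have "X $ i $ j = 0" for i j using diag eq[of i k] by (cases "i = j") auto
      then show False using X(3) by (simp add: vec_eq_iff)
    qed
    then obtain i j where ij: "X $ i $ i \<noteq> X $ j $ j" by blast
    then have "i \<noteq> j" by auto
    have "matrix_unit i j ** X - X ** matrix_unit i j = cscale (X $ j $ j - X $ i $ i) (matrix_unit i j)"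
      using diag
      by (auto simp: vec_eq_iff matrix_unit_mult_left_nth matrix_unit_mult_right_nth matrix_unit_nth cscale_def)
    then have "cscale (X $ j $ j - X $ i $ i) (matrix_unit i j) \<in> V"
      using comm[OF X(1) \<open>i \<noteq> j\<close>] by simp
    then have "matrix_unit i j \<in> V" by (rule unscale) (use ij in simp)
    then show ?thesis using \<open>i \<noteq> j\<close> by blast
  qed
  then obtain i j where ij: "i \<noteq> j" "matrix_unit i j \<in> V" by blast
  have row: "matrix_unit a l \<in> V" if "matrix_unit a b \<in> V" "a \<noteq> b" "l \<noteq> a" for a b l
  proof (cases "l = b")
    case False
    have "0 - (matrix_unit b l ** matrix_unit a b - matrix_unit a b ** matrix_unit b l) \<in> V"
      using that False by (intro subspace_diff[OF V] subspace_0[OF V] comm) auto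
    then show ?thesis using that by (simp add: matrix_unit_mult)
  qed (use that in simp)
  have col: "matrix_unit k b \<in> V" if "matrix_unit a b \<in> V" "a \<noteq> b" "k \<noteq> b" for a b k
  proof (cases "k = a")
    case False
    have "matrix_unit k a ** matrix_unit a b - matrix_unit a b ** matrix_unit k a \<in> V"
      using that False by (intro comm) auto
    then show ?thesis using that by (simp add: matrix_unit_mult)
  qed (use that in simp)
  \<comment> \<open>The transposed unit serves the column \<open>i\<close>, which cannot be reached
    from \<open>matrix_unit i j\<close> by changing the column index within row
    \<open>i\<close>.\<close>
  have ji: "matrix_unit j i \<in> V"
    using sandwich[OF ij(2), of j i] ij(1) by (simp add: matrix_unit_nth)
  have off: "matrix_unit k l \<in> V" if "k \<noteq> l" for k l
  proof (cases "l = i")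
    case True
    then show ?thesis using col[OF ji] ij(1) that by simp
  next
    case False
    show ?thesis by (rule col[OF row[OF ij(2,1) False]]) (use False that in auto)
  qed
  have diag: "matrix_unit k k - matrix_unit l l \<in> V" for k l
  proof (cases "k = l")
    case False
    from comm[OF off[OF False[symmetric]] False] show ?thesis by (simp add: matrix_unit_mult)
  qed (simp add: subspace_0[OF V])
  show ?thesis
  proof
    fix Y :: "complex^'m^'m" assume "Y \<in> sl"
    then have tr: "(\<Sum>i\<in>UNIV. Y $ i $ i) = 0" by (simp add: sl_def trace_def)
    \<comment> \<open>Subtracting \<open>matrix_unit i i\<close> from every diagonal unit changes
      the expansion of \<open>Y\<close> by \<open>trace Y\<close> times that unit, hence not at
      all.\<close>
    define G where "G a b = (if a = b then matrix_unit a a - matrix_unit i i else matrix_unit a b)" for a b :: 'm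
    have "(\<Sum>a\<in>UNIV. \<Sum>b\<in>UNIV. cscale (Y $ a $ b) (G a b)) \<in> V"
      by (intro subspace_sum[OF V] cV) (simp add: G_def off diag)
    also have "(\<Sum>a\<in>UNIV. \<Sum>b\<in>UNIV. cscale (Y $ a $ b) (G a b)) = Y"
    proof -
      have "(\<Sum>a\<in>UNIV. \<Sum>b\<in>UNIV. Y $ a $ b * (if a = b then matrix_unit i i $ x $ y else 0)) = 0" for x y
        using tr by (simp add: mult_delta_right sum_distrib_right[symmetric])
      moreover have "(\<Sum>a\<in>UNIV. \<Sum>b\<in>UNIV. Y $ a $ b * matrix_unit a b $ x $ y) = Y $ x $ y" for x y
      proof -
        have "(\<Sum>b\<in>UNIV. Y $ a $ b * matrix_unit a b $ x $ y) = (if a = x then Y $ x $ y else 0)" for a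
          by (cases "x = a") (simp_all add: matrix_unit_nth mult_delta_right)
        then show ?thesis by simp
      qed
      moreover have "G a b $ x $ y = matrix_unit a b $ x $ y - (if a = b then matrix_unit i i $ x $ y else 0)"
        for a b x y by (simp add: G_def)
      ultimately show ?thesis
        by (simp add: vec_eq_iff cscale_def right_diff_distrib sum_subtractf)
    qed
    finally show "Y \<in> V" .
  qed
qed

section \<open>Nilpotent elements and their one-parameter groups\<close>

lemma matrix_power_Suc: "matrix_power X (Suc k) = X ** matrix_power X k"
  by (simp add: matrix_power_def)

lemma matrix_power_0: "matrix_power X 0 = mat 1"
  by (simp add: matrix_power_def)

lemma matrix_power_cscale: "matrix_power (cscale c X) k = cscale (c ^ k) (matrix_power X k)"
  by (induction k) (simp_all add: matrix_power_0 matrix_power_Suc cscale_mult_left cscale_mult_right cscale_cscale mult.commute)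

text \<open>The powers of \<open>B\<close> are eigenvectors of \<open>ad A\<close> with unbounded eigenvalues as long as they do
  not vanish.\<close>

lemma nilpotent_if_lie_bracket:
  fixes A B :: "complex^'m^'m"
  assumes "lie_bracket A B = cscale 2 B"
  shows "\<exists>k. matrix_power B k = 0"
proof (rule ccontr)
  assume nz: "\<nexists>k. matrix_power B k = 0"
  have br: "A ** matrix_power B k - matrix_power B k ** A = cscale (2 * of_nat k) (matrix_power B k)" for k
  proof (induction k)
    case (Suc k)
    let ?P = "matrix_power B k"
    have "A ** (B ** ?P) - (B ** ?P) ** A = (A ** B - B ** A) ** ?P + B ** (A ** ?P - ?P ** A)"
      by (simp add: matrix_mult.diff_left matrix_mult.diff_right matrix_mul_assoc)
    also have "\<dots> = cscale 2 (B ** ?P) + cscale (2 * of_nat k) (B ** ?P)"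
      using assms Suc by (simp add: lie_bracket_def cscale_mult_left cscale_mult_right)
    also have "\<dots> = cscale (2 * of_nat (Suc k)) (B ** ?P)"
      by (simp add: cscale_add_left[symmetric] distrib_left)
    finally show ?case by (simp add: matrix_power_Suc)
  qed (simp add: matrix_power_0)
  obtain K where K: "\<And>(X :: complex^'m^'m) (Y :: complex^'m^'m). norm (X ** Y) \<le> norm X * norm Y * K"
    using matrix_mult.bounded by blast
  obtain k :: nat where k: "real k > norm A * K" using reals_Archimedean2 by blast
  let ?P = "matrix_power B k"
  have "2 * real k * norm ?P = norm (A ** ?P - ?P ** A)"
    unfolding br norm_cscale by (simp add: norm_mult)
  also have "\<dots> \<le> norm A * norm ?P * K + norm ?P * norm A * K"
    by (intro order_trans[OF norm_triangle_ineq4] add_mono K)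
  also have "\<dots> = 2 * (norm A * K) * norm ?P" by simp
  finally have "real k \<le> norm A * K" using nz by simp
  then show False using k by simp
qed

lemma matrix_exp_nilpotent:
  assumes "matrix_power Z K = 0"
  shows "matrix_exp (cscale z Z) = (\<Sum>k<K. cscale (z ^ k / fact k) (matrix_power Z k))"
proof -
  have zero: "matrix_power Z k = 0" if "k \<ge> K" for k
    using that
  proof (induction k rule: dec_induct)
    case (step k)
    then show ?case by (simp add: matrix_power_Suc matrix_mult.zero_right)
  qed (rule assms)
  have "matrix_exp (cscale z Z) = (\<Sum>k<K. (1 / fact k) *\<^sub>R matrix_power (cscale z Z) k)"
    unfolding matrix_exp_def
  proof (rule suminf_finite)
    fix k assume "k \<notin> {..<K}"
    then have "matrix_power Z k = 0" by (intro zero) simp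
    then show "(1 / fact k) *\<^sub>R matrix_power (cscale z Z) k = 0"
      by (simp add: matrix_power_cscale)
  qed simp
  also have "\<dots> = (\<Sum>k<K. cscale (z ^ k / fact k) (matrix_power Z k))"
    by (intro sum.cong refl)
       (simp add: matrix_power_cscale cscale_of_real[symmetric] cscale_cscale)
  finally show ?thesis .
qed

lemma matrix_exp_nilpotent_poly:
  assumes "matrix_power Z K = 0"
  shows "\<exists>q. \<forall>z. matrix_exp (cscale z Z) $ i $ j = poly q z"
proof
  let ?q = "\<Sum>k<K. monom (matrix_power Z k $ i $ j / fact k) k"
  show "\<forall>z. matrix_exp (cscale z Z) $ i $ j = poly ?q z"
    unfolding matrix_exp_nilpotent[OF assms]
    by (simp add: cscale_def poly_sum poly_monom mult.commute)
qed

lemma matrix_exp_0: "matrix_exp (cscale 0 (Z :: complex^'m^'m)) = mat 1"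
proof -
  have "matrix_power (0 :: complex^'m^'m) 1 = 0"
    by (simp add: matrix_power_def matrix_mult.zero_left)
  from matrix_exp_nilpotent[OF this, of 1] show ?thesis by (simp add: matrix_power_0 cscale_def)
qed

lemma matrix_exp_nilpotent_derivative:
  fixes Z :: "complex^'m^'m"
  assumes "matrix_power Z K = 0"
  shows "((\<lambda>z. matrix_exp (cscale z Z)) has_derivative (\<lambda>h. cscale h Z)) (at 0)"
proof -
  \<comment> \<open>At least two terms of the series are kept, so that the linear term occurs
    whatever \<open>K\<close> is.\<close>
  have Z: "matrix_power Z (Suc (Suc K)) = 0"
    using assms by (simp add: matrix_power_Suc matrix_mult.zero_right)
  have "((\<lambda>z. z ^ k / fact k) has_derivative (\<lambda>h. of_nat k * h * 0 ^ (k - 1) / fact k)) (at (0::complex))" for k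
    unfolding divide_inverse
    using has_derivative_mult_left[OF has_derivative_power[OF has_derivative_ident[of "at (0::complex)"]], of k "inverse (fact k)"]
    by simp
  then have "((\<lambda>z. \<Sum>k<Suc (Suc K). cscale (z ^ k / fact k) (matrix_power Z k)) has_derivative
      (\<lambda>h. \<Sum>k<Suc (Suc K). cscale (of_nat k * h * 0 ^ (k - 1) / fact k) (matrix_power Z k))) (at 0)"
    by (intro has_derivative_sum bounded_linear.has_derivative[OF bounded_linear_cscale_left])
  moreover have "(\<Sum>k<Suc (Suc K). cscale (of_nat k * h * 0 ^ (k - 1) / fact k) (matrix_power Z k)) =
      cscale h Z" for h
  proof -
    \<comment> \<open>Besides \<open>k = 1\<close>, the power \<open>0 ^ (k - 1)\<close> equals 1
      also for \<open>k = 0\<close>, by truncated subtraction; there the factor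
      \<open>of_nat k\<close> vanishes.\<close>
    have "cscale (of_nat k * h * 0 ^ (k - 1) / fact k) (matrix_power Z k) = (if k = 1 then cscale h Z else 0)" for k
    proof (cases "k = 1")
      case False
      then have "of_nat k * h * 0 ^ (k - 1) = 0" by (cases k) auto
      then show ?thesis using False by (simp only: div_0 cscale_0 if_False)
    qed (simp add: matrix_power_def)
    then show ?thesis by simp
  qed
  ultimately show ?thesis by (simp only: matrix_exp_nilpotent[OF Z])
qed

section \<open>The span of the conjugates of a nilpotent element\<close>

lemma subspace_sl: "subspace (sl :: (complex^'m^'m) set)"
  by (rule subspaceI)
     (simp_all add: sl_def trace_def sum.distrib scaleR_sum_right[symmetric])

lemma linear_conjugate:
  fixes A B :: "complex^'m^'m"
  shows "linear (\<lambda>X. A ** X ** B)"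
  by (rule linearI)
     (simp_all add: matrix_mult.add_left matrix_mult.add_right matrix_mult.scaleR_left matrix_mult.scaleR_right)

lemma zariski_dense_preserves_subspace:
  fixes V :: "(complex^'m^'m) set"
  assumes dense: "zariski_dense B" and B: "B \<subseteq> carrier SL"
    and V: "subspace V" "V \<subseteq> sl"
    and inv: "\<And>A X. A \<in> B \<Longrightarrow> X \<in> V \<Longrightarrow> A ** X ** matrix_inv A \<in> V"
    and A: "A \<in> carrier SL" and X: "X \<in> V"
  shows "A ** X ** matrix_inv A \<in> V"
proof -
  let ?Y = "A ** X ** matrix_inv A"
  obtain v w where vw: "v \<in> span V" "\<And>u. u \<in> span V \<Longrightarrow> orthogonal w u" "?Y = v + w"
    using orthogonal_subspace_decomp_exists[of V ?Y] by metis
  have Xsl: "X \<in> sl" using V(2) X by blast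
  let ?p = "\<lambda>T. w \<bullet> T X"
  have "polynomial_on_End sl ?p"
    by (rule polynomial_on_End.coeff[OF Xsl]) (simp add: bounded_linear.linear bounded_linear_inner_right)
  then have closed: "closedin (zariski_topology sl) (zero_locus sl {?p})"
    unfolding closedin_zariski by blast
  have "Ad ` B \<subseteq> zero_locus sl {?p}"
  proof
    fix T assume "T \<in> Ad ` B"
    then obtain b where b: "b \<in> B" "T = Ad b" by blast
    have "T X \<in> V" using inv[OF b(1) X] Xsl by (simp add: b(2) Ad_def)
    then have "w \<bullet> T X = 0" using vw(2) by (simp add: orthogonal_def span_base)
    then show "T \<in> zero_locus sl {?p}"
      using Ad_in_GL_on[of b] b B by (auto simp: zero_locus_def)
  qed
  from closure_of_minimal[OF this closed]
  have "zariski_topology sl closure_of (Ad ` B) \<subseteq> zero_locus sl {?p}" .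
  moreover have "Ad A \<in> zariski_topology sl closure_of (Ad ` B)"
  proof -
    have "Ad A \<in> subtopology (zariski_topology sl) (Ad ` carrier SL) closure_of (Ad ` B)"
      using dense A unfolding zariski_dense_def by blast
    moreover have "Ad ` carrier SL \<inter> Ad ` B = Ad ` B" using B by blast
    ultimately show ?thesis by (simp add: closure_of_subtopology)
  qed
  ultimately have "w \<bullet> ?Y = 0" using Xsl by (auto simp: zero_locus_def Ad_def)
  moreover have "w \<bullet> v = 0" using vw(2)[OF vw(1)] by (simp add: orthogonal_def)
  ultimately have "w = 0" by (simp add: vw(3) inner_add_right)
  then show ?thesis using vw(1,3) V(1) by (simp add: span_eq_iff[THEN iffD2])
qed

lemma linear_image_span_subset:
  assumes "linear f" "f ` B \<subseteq> span B" "x \<in> span B"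
  shows "f x \<in> span B"
proof -
  have "f x \<in> span (f ` B)" using assms(1,3) by (simp add: linear_span_image)
  then show ?thesis using assms(2) span_minimal[OF _ subspace_span] by blast
qed

lemma carrier_SL: "A \<in> carrier SL \<longleftrightarrow> det A = 1"
  by (simp add: SL_def)

lemma m_inv_SL:
  assumes "det A = 1"
  shows "inv\<^bsub>SL\<^esub> A = matrix_inv A"
proof -
  have A: "A \<in> carrier SL" "matrix_inv A \<in> carrier SL"
    using assms det_matrix_inv[OF assms] by (simp_all add: SL_def)
  have "matrix_inv A \<otimes>\<^bsub>SL\<^esub> A = \<one>\<^bsub>SL\<^esub>"
    using det_nonzero_inverse(2)[of A] assms by (simp add: SL_def)
  then show ?thesis by (rule group.inv_equality[OF group_SL _ A])
qed

text \<open>\<open>span\<close> is the real span. Taking all complex multiples of \<open>Z\<close>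
  makes the span of this set a complex subspace.\<close>

definition conjugates :: "(complex^'m^'m) set \<Rightarrow> complex^'m^'m \<Rightarrow> (complex^'m^'m) set" where
  "conjugates S Z = {q ** cscale z Z ** matrix_inv q | q z. q \<in> S}"

text \<open>Elements of \<open>S\<close> conjugate the span into itself. As conjugation is injective
  and the dimension finite, they conjugate it onto itself, so that their inverses preserve it too.
  Hence it is invariant under the generated group, by density under all of \<open>SL\<close>, and
  \<open>Ad_invariant_subspace\<close> applies.\<close>

lemma span_conjugates:
  fixes \<Gamma> :: "(complex^'m^'m) set"
  assumes S: "S \<subseteq> carrier SL" "mat 1 \<in> S" "\<And>A B. A \<in> S \<Longrightarrow> B \<in> S \<Longrightarrow> A ** B \<in> S"
    and \<Gamma>: "\<Gamma> \<subseteq> S" "zariski_dense (generate SL \<Gamma>)"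
    and Z: "Z \<in> sl" "Z \<noteq> 0"
  shows "sl \<subseteq> span (conjugates S Z)"
proof (rule Ad_invariant_subspace)
  let ?G = "conjugates S Z"
  show V: "subspace (span ?G)" by (rule subspace_span)
  have "?G \<subseteq> sl"
    using S(1) Z(1) by (auto simp: conjugates_def sl_def trace_conjugate SL_def trace_cscale)
  then have Vsl: "span ?G \<subseteq> sl" by (rule span_minimal[OF _ subspace_sl])
  show "cscale c X \<in> span ?G" if "X \<in> span ?G" for c X
  proof (rule linear_image_span_subset[OF _ _ that])
    show "linear (cscale c)" using bounded_linear_cscale by (rule bounded_linear.linear)
    have "cscale c Y \<in> ?G" if Y: "Y \<in> ?G" for Y
    proof -
      obtain q z where q: "q \<in> S" "Y = q ** cscale z Z ** matrix_inv q"
        using Y unfolding conjugates_def by blast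
      then have "cscale c Y = q ** cscale (c * z) Z ** matrix_inv q"
        by (simp add: cscale_mult_left cscale_mult_right cscale_cscale)
      then show ?thesis unfolding conjugates_def using q(1) by blast
    qed
    then show "cscale c ` ?G \<subseteq> span ?G" using span_base by blast
  qed
  have S_inv: "A ** X ** matrix_inv A \<in> span ?G" if "A \<in> S" "X \<in> span ?G" for A X
  proof (rule linear_image_span_subset[OF linear_conjugate _ that(2)])
    have "A ** Y ** matrix_inv A \<in> ?G" if Y: "Y \<in> ?G" for Y
    proof -
      obtain q z where q: "q \<in> S" "Y = q ** cscale z Z ** matrix_inv q"
        using Y unfolding conjugates_def by blast
      have "det A = 1" "det q = 1" using \<open>A \<in> S\<close> q(1) S(1) by (auto simp: SL_def)
      then have "(A ** q) ** (matrix_inv q ** matrix_inv A) = mat 1"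
        using det_nonzero_inverse(1)[of A] det_nonzero_inverse(1)[of q]
        by (metis matrix_mul_assoc matrix_mul_rid zero_neq_one)
      then have "matrix_inv (A ** q) = matrix_inv q ** matrix_inv A" by (rule matrix_inv_eqI)
      then have "A ** Y ** matrix_inv A = (A ** q) ** cscale z Z ** matrix_inv (A ** q)"
        by (simp add: q(2) matrix_mul_assoc)
      then show ?thesis unfolding conjugates_def using S(3)[OF \<open>A \<in> S\<close> q(1)] by blast
    qed
    then show "(\<lambda>X. A ** X ** matrix_inv A) ` ?G \<subseteq> span ?G" using span_base by blast
  qed
  have gen: "\<forall>X\<in>span ?G. A ** X ** matrix_inv A \<in> span ?G" if "A \<in> generate SL \<Gamma>" for A
    using that
  proof induction
    case one
    have "matrix_inv (mat 1) = (mat 1 :: complex^'m^'m)" by (rule matrix_inv_eqI) simp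
    then show ?case by (simp add: SL_def)
  next
    case (incl h)
    then show ?case using S_inv \<Gamma>(1) by blast
  next
    case (inv h)
    then have hS: "h \<in> S" using \<Gamma>(1) by blast
    then have h: "det h = 1" using S(1) by (auto simp: SL_def)
    let ?c = "\<lambda>X. h ** X ** matrix_inv h"
    have canc: "matrix_inv h ** ?c X ** h = X" for X
      using h det_nonzero_inverse(2)[of h] by (metis matrix_mul_assoc matrix_mul_lid matrix_mul_rid zero_neq_one)
    have "inj_on ?c (span ?G)" by (rule inj_on_inverseI) (rule canc)
    then have "dim (?c ` span ?G) = dim (span ?G)"
      by (intro dim_image_eq linear_conjugate) (simp only: span_span)
    moreover have "?c ` span ?G \<subseteq> span ?G" using S_inv[OF hS] by blast
    ultimately have eq: "?c ` span ?G = span ?G"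
      by (intro subspace_dim_equal linear_subspace_image linear_conjugate subspace_span) auto
    have "matrix_inv (matrix_inv h) = h"
      using h det_nonzero_inverse(2)[of h] by (intro matrix_inv_eqI) simp
    then show ?case unfolding m_inv_SL[OF h] using eq canc by (metis (no_types, lifting) imageE)
  next
    case (eng h1 h2)
    have "det h1 = 1" "det h2 = 1"
      using eng(1,2) group.generate_in_carrier[OF group_SL] \<Gamma>(1) S(1) carrier_SL by blast+
    then have "(h1 ** h2) ** (matrix_inv h2 ** matrix_inv h1) = mat 1"
      using det_nonzero_inverse(1)[of h1] det_nonzero_inverse(1)[of h2]
      by (metis matrix_mul_assoc matrix_mul_rid zero_neq_one)
    then have "matrix_inv (h1 ** h2) = matrix_inv h2 ** matrix_inv h1" by (rule matrix_inv_eqI)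
    then have "h1 ** h2 ** X ** matrix_inv (h1 ** h2) = h1 ** (h2 ** X ** matrix_inv h2) ** matrix_inv h1" for X
      by (simp add: matrix_mul_assoc)
    then show ?case using eng.IH by (simp add: SL_def)
  qed
  show "A ** X ** matrix_inv A \<in> span ?G" if "det A = 1" "X \<in> span ?G" for A X
  proof (rule zariski_dense_preserves_subspace[OF \<Gamma>(2) _ V Vsl])
    show "generate SL \<Gamma> \<subseteq> carrier SL"
      using \<Gamma>(1) S(1) by (intro group.generate_incl[OF group_SL]) blast
  qed (use gen that in \<open>auto simp: SL_def\<close>)
  have "matrix_inv (mat 1) = (mat 1 :: complex^'m^'m)" by (rule matrix_inv_eqI) simp
  then have "Z = mat 1 ** cscale 1 Z ** matrix_inv (mat 1)" by simp
  then have "Z \<in> ?G" unfolding conjugates_def using S(2) by blast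
  then show "Z \<in> span ?G" by (rule span_base)
qed (rule Z)+

section \<open>Polynomial maps into the semigroup\<close>

text \<open>As vectors, matrices become arguments and values of polynomial maps, and
  \<open>vec.subspace\<close> and \<open>vec.dim\<close> provide complex subspaces and dimensions
  for them.\<close>

definition flatten :: "complex^'m^'m \<Rightarrow> complex^('m \<times> 'm)" where
  "flatten A = (\<chi> p. A $ fst p $ snd p)"

definition unflatten :: "complex^('m \<times> 'm) \<Rightarrow> complex^'m^'m" where
  "unflatten v = (\<chi> i j. v $ (i, j))"

lemma unflatten_flatten [simp]: "unflatten (flatten A) = A"
  by (simp add: flatten_def unflatten_def vec_eq_iff)

lemma flatten_unflatten [simp]: "flatten (unflatten v) = v"
  by (simp add: flatten_def unflatten_def vec_eq_iff)

lemma linear_flatten: "linear flatten"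
  by (rule linearI) (simp_all add: flatten_def vec_eq_iff)

lemma flatten_cscale: "flatten (cscale c A) = c *s flatten A"
  by (simp add: flatten_def cscale_def vec_eq_iff)

lemma unflatten_diff: "unflatten (v - w) = unflatten v - unflatten w"
  by (simp add: unflatten_def vec_eq_iff)

lemma unflatten_scale: "unflatten (c *s v) = cscale c (unflatten v)"
  by (simp add: unflatten_def cscale_def vec_eq_iff)

lemma polynomial_fn_flatten:
  "(\<And>i j. polynomial_fn (\<lambda>v. f v $ i $ j)) \<Longrightarrow> polynomial_fn (\<lambda>v. flatten (f v) $ p)"
  by (simp add: flatten_def)

lemma polynomial_fn_matrix_mult:
  assumes "\<And>i j. polynomial_fn (\<lambda>v. A v $ i $ j)" "\<And>i j. polynomial_fn (\<lambda>v. B v $ i $ j)"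
  shows "polynomial_fn (\<lambda>v. (A v ** B v) $ i $ j)"
  unfolding matrix_matrix_mult_def vec_lambda_beta
  by (intro polynomial_fn_sum polynomial_fn.mult assms)

lemma polynomial_fn_poly:
  assumes "polynomial_fn \<phi>"
  shows "polynomial_fn (\<lambda>v. poly q (\<phi> v))"
  unfolding poly_altdef
  by (intro polynomial_fn_sum polynomial_fn.mult polynomial_fn.const polynomial_fn_power assms)

lemma polynomial_fn_shear:
  fixes y :: "complex^'n"
  assumes "polynomial_fn \<phi>"
  shows "polynomial_fn (\<lambda>v. (v - \<phi> v *s y) $ i)"
  unfolding vector_minus_component vector_smult_component
  by (intro polynomial_fn_diff polynomial_fn.mult polynomial_fn.const polynomial_fn.coord assms)

lemma bounded_linear_dot: "bounded_linear (\<lambda>v :: complex^'n. \<Sum>j\<in>UNIV. c j * v $ j)"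
  by (intro bounded_linear_sum bounded_linear_const_mult bounded_linear_vec_nth)

lemma bounded_linear_vector_scalar_left: "bounded_linear (\<lambda>c. c *s (y :: complex^'n))"
  by (rule bounded_linear_intro[where K = "norm y"])
     (simp_all add: vec_eq_iff distrib_right norm_vector_scalar_mult)

text \<open>A basis of \<open>W\<close> stays independent when \<open>y\<close> is added, so a
  complex linear map can be prescribed on it; one coordinate of that map is the functional. It is
  given by coefficients because it has to be recognised as a polynomial.\<close>

lemma separating_functional:
  fixes W :: "(complex^'n) set"
  assumes W: "vec.subspace W" and y: "y \<notin> W"
  obtains c where "(\<Sum>j\<in>UNIV. c j * y $ j) = 1" "\<And>w. w \<in> W \<Longrightarrow> (\<Sum>j\<in>UNIV. c j * w $ j) = 0"
proof -
  obtain B where B: "B \<subseteq> W" "vec.independent B" "W \<subseteq> vec.span B"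
    using vec.basis_exists[of W] by metis
  have "vec.span B \<subseteq> W" using B(1) W by (rule vec.span_minimal)
  then have "y \<notin> vec.span B" using y by blast
  then have ind: "vec.independent (insert y B)" using B(2) by (rule vec.independent_insertI)
  fix k :: 'n
  obtain g where g: "Vector_Spaces.linear (*s) (*s) g"
    "\<forall>x\<in>insert y B. g x = (if x = y then axis k 1 else 0 :: complex^'n)"
    using vec.linear_independent_extend[OF ind, of "\<lambda>x. if x = y then axis k 1 else 0"] by blast
  have "y \<notin> B" using B(1) y by blast
  then have gB: "g b = 0" if "b \<in> B" for b using g(2) that by auto
  have gW: "g w = 0" if "w \<in> W" for w
    using vec.linear_eq_0_on_span[OF g(1) gB] that B(3) by blast
  have gmat: "g v $ k = (\<Sum>j\<in>UNIV. matrix g $ k $ j * v $ j)" for v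
    using matrix_works[OF g(1), of v] by (simp add: matrix_vector_mult_def flip: \<open>matrix g *v v = g v\<close>)
  show ?thesis
  proof (rule that[of "\<lambda>j. matrix g $ k $ j"])
    show "(\<Sum>j\<in>UNIV. matrix g $ k $ j * y $ j) = 1"
      using g(2) by (simp add: gmat[symmetric])
    show "(\<Sum>j\<in>UNIV. matrix g $ k $ j * w $ j) = 0" if "w \<in> W" for w
      using gW[OF that] by (simp add: gmat[symmetric])
  qed
qed

text \<open>The one-parameter group enters as a polynomial curve through the identity with velocity
  \<open>Z\<close>; density of the group enters through \<open>span_S\<close>.\<close>

locale unipotent_semigroup =
  fixes S :: "(complex^'m^'m) set" and E :: "complex \<Rightarrow> complex^'m^'m" and Z :: "complex^'m^'m"
  assumes det_S: "A \<in> S \<Longrightarrow> det A = 1"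
    and mult_S: "A \<in> S \<Longrightarrow> B \<in> S \<Longrightarrow> A ** B \<in> S"
    and E_S: "E z \<in> S"
    and E_poly: "\<exists>q. \<forall>z. E z $ i $ j = poly q z"
    and E_0: "E 0 = mat 1"
    and E_derivative: "(E has_derivative (\<lambda>h. cscale h Z)) (at 0)"
    and span_S: "sl \<subseteq> span (conjugates S Z)"
begin

text \<open>\<open>l\<close> is the derivative at the origin, right translated to the identity.\<close>

definition tangent :: "(complex^('m \<times> 'm)) set \<Rightarrow> bool" where
  "tangent W \<longleftrightarrow> vec.subspace W \<and> (\<exists>f l. (\<forall>i j. polynomial_fn (\<lambda>v. f v $ i $ j)) \<and> (\<forall>v. f v \<in> S) \<and>
     (f has_derivative (\<lambda>v. l v ** f 0)) (at 0) \<and> (\<forall>v\<in>W. l v = unflatten v))"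

lemma polynomial_fn_E:
  assumes "polynomial_fn \<phi>"
  shows "polynomial_fn (\<lambda>v. E (\<phi> v) $ i $ j)"
proof -
  obtain q where "\<forall>z. E z $ i $ j = poly q z" using E_poly by blast
  then show ?thesis using polynomial_fn_poly[OF assms, of q] by simp
qed

lemma tangent_0: "tangent {0}"
  unfolding tangent_def
proof (intro conjI, rule vec.subspace_single_0, rule exI[of _ "\<lambda>v. E 0"], rule exI[of _ "\<lambda>v. 0"],
    intro conjI allI ballI)
  show "((\<lambda>v. E 0) has_derivative (\<lambda>v. 0 ** E 0)) (at (0 :: complex^('m \<times> 'm)))"
    by (simp add: matrix_mult.zero_left)
qed (auto simp: E_S unflatten_def vec_eq_iff intro: polynomial_fn.const)

text \<open>Some conjugate of a multiple of \<open>Z\<close>, transported by \<open>f 0\<close>,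
  points in a direction \<open>y\<close> outside \<open>W\<close>. Appending the factor
  \<open>q ** E (\<phi> v * z)\<close> on the right, where the functional \<open>\<phi>\<close> is 1
  at \<open>y\<close> and 0 on \<open>W\<close>, adds exactly this direction to the
  derivative.\<close>

lemma tangent_insert:
  assumes W: "tangent W" and sl: "\<not> flatten ` sl \<subseteq> W"
  shows "\<exists>y. y \<notin> W \<and> tangent (vec.span (insert y W))"
proof -
  obtain f l where subW: "vec.subspace W" and f: "\<forall>i j. polynomial_fn (\<lambda>v. f v $ i $ j)" "\<forall>v. f v \<in> S"
    and der: "(f has_derivative (\<lambda>v. l v ** f 0)) (at 0)" and l: "\<forall>v\<in>W. l v = unflatten v"
    using W unfolding tangent_def by (elim conjE exE)
  have f0: "det (f 0) = 1" using f(2) det_S by blast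
  have inv0: "f 0 ** matrix_inv (f 0) = mat 1" "matrix_inv (f 0) ** f 0 = mat 1"
    using det_nonzero_inverse[of "f 0"] f0 by simp_all
  have "\<exists>M\<in>conjugates S Z. flatten (f 0 ** M ** matrix_inv (f 0)) \<notin> W"
  proof (rule ccontr)
    assume "\<not> ?thesis"
    then have sub: "conjugates S Z \<subseteq> {M. flatten (f 0 ** M ** matrix_inv (f 0)) \<in> W}" by blast
    have "subspace {M. flatten (f 0 ** M ** matrix_inv (f 0)) \<in> W}"
    proof (rule subspaceI)
      fix M N and r :: real
      assume M: "M \<in> {M. flatten (f 0 ** M ** matrix_inv (f 0)) \<in> W}"
      have "flatten (f 0 ** (r *\<^sub>R M) ** matrix_inv (f 0)) =
          of_real r *s flatten (f 0 ** M ** matrix_inv (f 0))"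
        by (simp add: cscale_of_real[symmetric] flatten_cscale[symmetric] cscale_mult_left cscale_mult_right)
      then show "r *\<^sub>R M \<in> {M. flatten (f 0 ** M ** matrix_inv (f 0)) \<in> W}"
        using M vec.subspace_scale[OF subW] by simp
      assume N: "N \<in> {M. flatten (f 0 ** M ** matrix_inv (f 0)) \<in> W}"
      have "flatten (f 0 ** (M + N) ** matrix_inv (f 0)) =
          flatten (f 0 ** M ** matrix_inv (f 0)) + flatten (f 0 ** N ** matrix_inv (f 0))"
        by (simp add: matrix_mult.add_left matrix_mult.add_right linear_add[OF linear_flatten])
      then show "M + N \<in> {M. flatten (f 0 ** M ** matrix_inv (f 0)) \<in> W}"
        using M N vec.subspace_add[OF subW] by simp
    qed (simp add: matrix_mult.zero_left matrix_mult.zero_right linear_0[OF linear_flatten] vec.subspace_0[OF subW])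
    then have *: "flatten (f 0 ** M ** matrix_inv (f 0)) \<in> W" if "M \<in> sl" for M
      using span_minimal[OF sub] span_S that by blast
    \<comment> \<open>Conjugation by \<open>f 0\<close> maps \<open>sl\<close> onto itself, so if
      its image lies in \<open>W\<close>, then so does all of \<open>sl\<close>.\<close>
    have "flatten ` sl \<subseteq> W"
    proof (intro image_subsetI)
      fix X :: "complex^'m^'m" assume X: "X \<in> sl"
      have "trace (matrix_inv (f 0) ** X ** f 0) = trace X"
        using inv0(1) by (metis trace_mul_sym matrix_mul_assoc matrix_mul_lid)
      then have "matrix_inv (f 0) ** X ** f 0 \<in> sl" using X by (simp add: sl_def)
      from *[OF this] show "flatten X \<in> W"
        using inv0(1) by (metis matrix_mul_assoc matrix_mul_lid matrix_mul_rid)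
    qed
    then show False using sl by blast
  qed
  then obtain q z where q: "q \<in> S"
    and "flatten (f 0 ** (q ** cscale z Z ** matrix_inv q) ** matrix_inv (f 0)) \<notin> W"
    unfolding conjugates_def by blast
  define y where "y = flatten (f 0 ** (q ** cscale z Z ** matrix_inv q) ** matrix_inv (f 0))"
  have y: "y \<notin> W" unfolding y_def by fact
  have invq: "matrix_inv q ** q = mat 1" using det_nonzero_inverse(2)[of q] det_S[OF q] by simp
  \<comment> \<open>\<open>unflatten y\<close> is the velocity of the new factor, seen after right
    translation of \<open>f 0 ** q\<close> to the identity.\<close>
  have uy: "unflatten y ** (f 0 ** q) = f 0 ** q ** cscale z Z"
  proof -
    have "unflatten y ** (f 0 ** q) =
        f 0 ** (q ** cscale z Z ** matrix_inv q) ** (matrix_inv (f 0) ** f 0) ** q"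
      by (simp add: y_def matrix_mul_assoc)
    also have "\<dots> = f 0 ** q ** cscale z Z ** (matrix_inv q ** q)"
      unfolding inv0(2) by (simp add: matrix_mul_assoc)
    finally show ?thesis by (simp add: invq)
  qed
  obtain c where c: "(\<Sum>j\<in>UNIV. c j * y $ j) = 1" "\<And>w. w \<in> W \<Longrightarrow> (\<Sum>j\<in>UNIV. c j * w $ j) = 0"
    by (rule separating_functional[OF subW y]) blast
  define \<phi> where "\<phi> v = (\<Sum>j\<in>UNIV. c j * v $ j)" for v
  have \<phi>: "polynomial_fn \<phi>"
    unfolding \<phi>_def by (intro polynomial_fn_sum polynomial_fn.mult polynomial_fn.const polynomial_fn.coord)
  have \<phi>z: "polynomial_fn (\<lambda>v. \<phi> v * z)" by (intro polynomial_fn.mult polynomial_fn.const \<phi>)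
  have bl: "bounded_linear \<phi>" unfolding \<phi>_def by (rule bounded_linear_dot)
  have \<phi>0: "\<phi> 0 = 0" using bl by (simp add: linear_simps)
  \<comment> \<open>On the span of \<open>y\<close> and \<open>W\<close>, the argument of
    \<open>f\<close> is the projection to \<open>W\<close> along \<open>y\<close>: the old map
    handles the part in \<open>W\<close>, where \<open>l\<close> is known, and \<open>E\<close>
    handles the multiple of \<open>y\<close>.\<close>
  define g where "g v = f (v - \<phi> v *s y) ** q ** E (\<phi> v * z)" for v
  define k where "k v = l (v - \<phi> v *s y) + cscale (\<phi> v) (unflatten y)" for v
  have g0: "g 0 = f 0 ** q" by (simp add: g_def \<phi>0 E_0)
  have gpoly: "polynomial_fn (\<lambda>v. g v $ i $ j)" for i j
    unfolding g_def
    by (intro polynomial_fn_matrix_mult polynomial_fn.const polynomial_fn_E \<phi>z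
        polynomial_fn_compose[of "\<lambda>v. f v $ _ $ _", OF f(1)[rule_format]] polynomial_fn_shear \<phi>)
  have "(g has_derivative (\<lambda>v. k v ** g 0)) (at 0)"
  proof -
    have d1: "((\<lambda>v. v - \<phi> v *s y) has_derivative (\<lambda>v. v - \<phi> v *s y)) (at 0)"
      by (intro bounded_linear_imp_has_derivative bounded_linear_sub bounded_linear_ident
          bounded_linear_compose[OF bounded_linear_vector_scalar_left bl])
    have d2: "((\<lambda>v. f (v - \<phi> v *s y)) has_derivative (\<lambda>v. l (v - \<phi> v *s y) ** f 0)) (at 0)"
      by (rule has_derivative_compose[OF d1, of f "\<lambda>v. l v ** f 0"]) (simp add: \<phi>0 der)
    have d3: "((\<lambda>v. \<phi> v * z) has_derivative (\<lambda>v. \<phi> v * z)) (at 0)"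
      by (intro bounded_linear_imp_has_derivative bounded_linear_mult_const bl)
    have d4: "((\<lambda>v. E (\<phi> v * z)) has_derivative (\<lambda>v. cscale (\<phi> v * z) Z)) (at 0)"
      by (rule has_derivative_compose[OF d3, of E "\<lambda>h. cscale h Z"]) (simp add: \<phi>0 E_derivative)
    have d5: "((\<lambda>v. f (v - \<phi> v *s y) ** q) has_derivative (\<lambda>v. l (v - \<phi> v *s y) ** f 0 ** q)) (at 0)"
      by (rule bounded_linear.has_derivative[OF matrix_mult.bounded_linear_left d2])
    have "(g has_derivative (\<lambda>v. f 0 ** q ** cscale (\<phi> v * z) Z + l (v - \<phi> v *s y) ** f 0 ** q)) (at 0)"
      using matrix_mult.FDERIV[OF d5 d4] unfolding g_def by (simp add: \<phi>0 E_0)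
    moreover have "f 0 ** q ** cscale (\<phi> v * z) Z + l (v - \<phi> v *s y) ** f 0 ** q = k v ** g 0" for v
    proof -
      have "cscale (\<phi> v) (unflatten y) ** (f 0 ** q) = f 0 ** q ** cscale (\<phi> v * z) Z"
        unfolding cscale_mult_left uy by (simp add: cscale_mult_right cscale_cscale)
      then show ?thesis by (simp add: k_def g0 matrix_mult.add_left matrix_mul_assoc)
    qed
    ultimately show ?thesis by simp
  qed
  moreover have "k v = unflatten v" if v: "v \<in> vec.span (insert y W)" for v
  proof -
    obtain a where "v - a *s y \<in> vec.span W" using v unfolding vec.span_insert by blast
    then have w: "v - a *s y \<in> W" using subW by (simp add: vec.span_eq_iff[THEN iffD2])
    have "\<phi> v = \<phi> (v - a *s y) + a * \<phi> y"
      unfolding \<phi>_def by (simp add: algebra_simps sum_subtractf sum_distrib_left)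
    then have "\<phi> v = a" using c(1) c(2)[OF w] by (simp only: \<phi>_def mult_1_right add_0)
    then show ?thesis using l w by (simp add: k_def unflatten_diff unflatten_scale)
  qed
  moreover have "g v \<in> S" for v
    unfolding g_def using f(2) by (intro mult_S E_S q) blast
  ultimately have "tangent (vec.span (insert y W))"
    unfolding tangent_def using gpoly vec.subspace_span by blast
  then show ?thesis using y by blast
qed

text \<open>A tangent subspace of maximal complex dimension exists, since \<open>{0}\<close> is one,
  and by \<open>tangent_insert\<close> it can only be one that contains \<open>sl\<close>.\<close>

lemma tangent_sl: "\<exists>W. tangent W \<and> flatten ` sl \<subseteq> W"
proof -
  define P where "P d \<longleftrightarrow> (\<exists>W. tangent W \<and> vec.dim W = d)" for d
  have "P 0" unfolding P_def using tangent_0 by (intro exI[of _ "{0}"]) simp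
  moreover have "d \<le> CARD('m \<times> 'm)" if "P d" for d
  proof -
    obtain W :: "(complex^('m \<times> 'm)) set" where "vec.dim W = d" using \<open>P d\<close> unfolding P_def by blast
    then show ?thesis using vec.dim_subset[OF subset_UNIV, of W] by (simp only: vec_dim_card)
  qed
  ultimately obtain d where d: "P d" "\<And>e. P e \<Longrightarrow> e \<le> d"
    using GreatestI_nat[of P 0] Greatest_le_nat[of P] by metis
  obtain W where W: "tangent W" "vec.dim W = d" using d(1) unfolding P_def by blast
  show ?thesis
  proof (rule ccontr)
    assume "\<nexists>W. tangent W \<and> flatten ` sl \<subseteq> W"
    then have "\<not> flatten ` sl \<subseteq> W" using W(1) by blast
    from tangent_insert[OF W(1) this] obtain y where y: "y \<notin> W" "tangent (vec.span (insert y W))" by blast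
    have "y \<notin> vec.span W" using y(1) W(1) by (simp add: tangent_def vec.span_eq_iff[THEN iffD2])
    then have "vec.dim (vec.span (insert y W)) = d + 1" using W(2) by (simp add: vec.dim_insert)
    then have "P (d + 1)" using y(2) unfolding P_def by blast
    then show False using d(2) by fastforce
  qed
qed

text \<open>\<open>undefined\<close> serves as an arbitrary but fixed index.\<close>

definition det_diag :: "complex \<Rightarrow> complex^'m^'m" where
  "det_diag c = mat 1 + cscale (c - 1) (matrix_unit undefined undefined)"

lemma det_diag_mult: "det_diag c ** det_diag d = det_diag (c * d)"
  by (simp add: det_diag_def matrix_mult.add_left matrix_mult.add_right cscale_mult_left cscale_mult_right
      matrix_unit_mult)
    (simp add: vec_eq_iff cscale_def algebra_simps)

lemma det_det_diag: "det (det_diag c) = c"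
proof -
  have nth: "det_diag c $ i $ j = (if i = j then if i = undefined then c else 1 else 0)" for i j
    by (simp add: det_diag_def mat_def matrix_unit_nth cscale_def)
  have "det (det_diag c) = (\<Prod>i\<in>UNIV. if i = (undefined :: 'm) then c else 1)"
    by (subst det_diagonal) (simp_all add: nth)
  then show ?thesis by simp
qed

text \<open>All values of \<open>f\<close> have determinant 1, so
  \<open>polynomial_map_dominant\<close> cannot be applied to \<open>f\<close> itself. The factor
  \<open>det_diag (1 + t v)\<close> supplies the missing direction, transversal to
  \<open>sl\<close>. It is recovered from the determinant of the product, so normalising the
  determinant of a generic matrix leaves a value of \<open>f\<close>.\<close>

lemma generic_in_S:
  obtains a where "polynomial_fn a" "\<exists>v. a v \<noteq> 0"
    "\<And>A. a (flatten A) \<noteq> 0 \<Longrightarrow> det A \<noteq> 0 \<Longrightarrow> det_diag (1 / det A) ** A \<in> S"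
proof -
  obtain W f l where W: "flatten ` sl \<subseteq> W" and f: "\<forall>i j. polynomial_fn (\<lambda>v. f v $ i $ j)" "\<forall>v. f v \<in> S"
    and der: "(f has_derivative (\<lambda>v. l v ** f 0)) (at 0)" and l: "\<forall>v\<in>W. l v = unflatten v"
    using tangent_sl unfolding tangent_def by (elim exE conjE)
  let ?e = "matrix_unit undefined undefined :: complex^'m^'m"
  define t where "t v = (\<Sum>i\<in>UNIV. v $ (i, i))" for v :: "complex^('m \<times> 'm)"
  have t: "t v = trace (unflatten v)" for v by (simp add: t_def trace_def unflatten_def)
  have tpoly: "polynomial_fn t" unfolding t_def by (intro polynomial_fn_sum polynomial_fn.coord)
  have bl: "bounded_linear t" unfolding t_def by (intro bounded_linear_sum bounded_linear_vec_nth)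
  have t0: "t 0 = 0" by (simp add: t_def)
  \<comment> \<open>\<open>t\<close> is the trace and \<open>?e\<close> has trace 1, so the argument
    of \<open>f\<close> is a projection to \<open>sl\<close>; the derivative of the diagonal factor
    restores the multiple of \<open>?e\<close> that was removed.\<close>
  define G where "G v = det_diag (1 + t v) ** f (v - t v *s flatten ?e)" for v
  define F where "F v = flatten (G v)" for v
  have dpoly: "polynomial_fn (\<lambda>v. det_diag (1 + t v) $ i $ j)" for i j
    unfolding det_diag_def cscale_def vector_add_component vec_lambda_beta
    by (intro polynomial_fn.add polynomial_fn.mult polynomial_fn_diff polynomial_fn.const tpoly)
  have Fpoly: "polynomial_fn (\<lambda>v. F v $ p)" for p
    unfolding F_def G_def
    by (intro polynomial_fn_flatten polynomial_fn_matrix_mult dpoly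
        polynomial_fn_compose[of "\<lambda>v. f v $ _ $ _", OF f(1)[rule_format]] polynomial_fn_shear tpoly)
  have "(G has_derivative (\<lambda>v. unflatten v ** f 0)) (at 0)"
  proof -
    have d1: "((\<lambda>v. v - t v *s flatten ?e) has_derivative (\<lambda>v. v - t v *s flatten ?e)) (at 0)"
      by (intro bounded_linear_imp_has_derivative bounded_linear_sub bounded_linear_ident
          bounded_linear_compose[OF bounded_linear_vector_scalar_left bl])
    have d2: "((\<lambda>v. f (v - t v *s flatten ?e)) has_derivative (\<lambda>v. l (v - t v *s flatten ?e) ** f 0)) (at 0)"
      by (rule has_derivative_compose[OF d1, of f "\<lambda>v. l v ** f 0"]) (simp add: t0 der)
    have d3: "((\<lambda>v. det_diag (1 + t v)) has_derivative (\<lambda>v. cscale (t v) ?e)) (at 0)"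
      unfolding det_diag_def
      using has_derivative_add[OF has_derivative_const[of "mat 1" "at 0"]
          bounded_linear_imp_has_derivative[OF bounded_linear_compose[OF bounded_linear_cscale_left bl], of ?e "at 0"]]
      by simp
    have "det_diag 1 = mat 1" by (simp add: det_diag_def)
    then have "(G has_derivative (\<lambda>v. l (v - t v *s flatten ?e) ** f 0 + cscale (t v) ?e ** f 0)) (at 0)"
      using matrix_mult.FDERIV[OF d3 d2] unfolding G_def by (simp add: t0)
    moreover have "l (v - t v *s flatten ?e) ** f 0 + cscale (t v) ?e ** f 0 = unflatten v ** f 0" for v
    proof -
      have "trace ?e = 1" by (simp add: trace_def matrix_unit_nth)
      then have "unflatten (v - t v *s flatten ?e) \<in> sl"
        by (simp add: sl_def t unflatten_diff unflatten_scale trace_sub trace_cscale)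
      then have "v - t v *s flatten ?e \<in> W" using W by (metis flatten_unflatten image_subset_iff)
      then have "l (v - t v *s flatten ?e) = unflatten v - cscale (t v) ?e"
        using l by (simp add: unflatten_diff unflatten_scale)
      then show ?thesis by (simp add: matrix_mult.diff_left)
    qed
    ultimately show ?thesis by simp
  qed
  then have Fder: "(F has_derivative (\<lambda>v. flatten (unflatten v ** f 0))) (at 0)"
    unfolding F_def by (rule bounded_linear.has_derivative[OF linear_conv_bounded_linear[THEN iffD1, OF linear_flatten]])
  have f0: "f 0 ** matrix_inv (f 0) = mat 1"
    using f(2) det_S det_nonzero_inverse(1)[of "f 0"] by simp
  have inj: "inj (\<lambda>v. flatten (unflatten v ** f 0))"
  proof (rule inj_on_inverseI)
    show "flatten (unflatten (flatten (unflatten v ** f 0)) ** matrix_inv (f 0)) = v" for v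
      by (simp add: matrix_mul_assoc[symmetric] f0)
  qed
  obtain a where a: "polynomial_fn a" "\<exists>v. a v \<noteq> 0" "{v. a v \<noteq> 0} \<subseteq> range F"
    by (rule polynomial_map_dominant[OF Fpoly Fder inj])
  show ?thesis
  proof (rule that[OF a(1,2)])
    fix A :: "complex^'m^'m" assume "a (flatten A) \<noteq> 0" and A: "det A \<noteq> 0"
    then obtain v where "flatten A = F v" using a(3) by blast
    then have v: "A = det_diag (1 + t v) ** f (v - t v *s flatten ?e)"
      unfolding F_def G_def by (metis unflatten_flatten)
    have "det A = 1 + t v" using v det_S f(2) by (simp add: det_mul det_det_diag)
    then have "det_diag (1 / det A) ** A = det_diag 1 ** f (v - t v *s flatten ?e)"
      using A by (subst v) (simp add: matrix_mul_assoc det_diag_mult)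
    then show "det_diag (1 / det A) ** A \<in> S" using f(2) by (simp add: det_diag_def)
  qed
qed

end

section \<open>Continuity of matrix inversion, by Cramer's rule\<close>

lemma matrix_inv_cramer:
  fixes A :: "complex^'m^'m"
  assumes "det A \<noteq> 0"
  shows "matrix_inv A $ k $ j = det (\<chi> i l. if l = k then axis j 1 $ i else A $ i $ l) / det A"
proof -
  have "A *v (matrix_inv A *v axis j 1) = axis j 1"
    by (simp add: matrix_vector_mul_assoc det_nonzero_inverse(1)[OF assms])
  then have "matrix_inv A *v axis j 1 = (\<chi> k. det (\<chi> i l. if l = k then axis j 1 $ i else A $ i $ l) / det A)"
    by (simp add: cramer[OF assms])
  moreover have "(matrix_inv A *v axis j 1) $ k = matrix_inv A $ k $ j"
    by (simp add: matrix_vector_mult_def axis_def mult_delta_right)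
  ultimately show ?thesis by simp
qed

lemma continuous_on_matrix_det:
  fixes A :: "'a::topological_space \<Rightarrow> complex^'m^'m"
  assumes "\<And>i j. continuous_on T (\<lambda>x. A x $ i $ j)"
  shows "continuous_on T (\<lambda>x. det (A x))"
  unfolding det_def by (intro continuous_intros assms)

lemma continuous_on_matrix_inv:
  fixes A :: "'a::topological_space \<Rightarrow> complex^'m^'m"
  assumes A: "continuous_on T A" and det: "\<And>x. x \<in> T \<Longrightarrow> det (A x) \<noteq> 0"
  shows "continuous_on T (\<lambda>x. matrix_inv (A x))"
proof -
  have entry: "continuous_on T (\<lambda>x. A x $ i $ j)" for i j
    by (intro continuous_intros A)
  have "continuous_on T (\<lambda>x. \<chi> k j. det (\<chi> i l. if l = k then axis j 1 $ i else A x $ i $ l) / det (A x))"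
  proof (intro continuous_on_vec_lambda continuous_on_divide continuous_on_matrix_det ballI det entry)
    show "continuous_on T (\<lambda>x. (\<chi> i l. if l = k then axis j 1 $ i else A x $ i $ l) $ a $ b)" for k j a b
      by (cases "b = k") (simp_all add: entry)
  qed
  then show ?thesis
    by (rule continuous_on_eq) (simp add: vec_eq_iff matrix_inv_cramer det)
qed

context unipotent_semigroup
begin

text \<open>Both factors of \<open>g = s (s\<^sup>-\<^sup>1 g)\<close> lie in the generic part of \<open>S\<close> for generic \<open>s\<close>.\<close>

lemma SL_subset_S:
  assumes g: "det g = 1"
  shows "g \<in> S"
proof -
  obtain a where a: "polynomial_fn a" "\<exists>v. a v \<noteq> 0"
    and aS: "\<And>A. a (flatten A) \<noteq> 0 \<Longrightarrow> det A \<noteq> 0 \<Longrightarrow> det_diag (1 / det A) ** A \<in> S"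
    by (rule generic_in_S) blast
  define r where "r v = a v * det (unflatten v)" for v
  have dpoly: "polynomial_fn (\<lambda>v. det (unflatten v))"
    by (intro polynomial_fn_det) (simp add: unflatten_def polynomial_fn.coord)
  have r: "polynomial_fn r" unfolding r_def by (intro polynomial_fn.mult a dpoly)
  have "\<exists>v. det (unflatten v :: complex^'m^'m) \<noteq> 0"
    by (rule exI[of _ "flatten (mat 1)"]) simp
  then obtain v1 where v1: "r v1 \<noteq> 0"
    unfolding r_def using polynomial_fn_nonzero_mult[OF a(1) dpoly a(2)] by blast
  define \<sigma> where "\<sigma> A = det_diag (1 / det A) ** A" for A :: "complex^'m^'m"
  have \<sigma>S: "\<sigma> A \<in> S" if "r (flatten A) \<noteq> 0" for A
    using aS that unfolding \<sigma>_def r_def by simp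
  have det_\<sigma>: "det (\<sigma> A) = 1" if "det A \<noteq> 0" for A
    using that by (simp add: \<sigma>_def det_mul det_det_diag)
  define c where "c = det (unflatten v1)"
  define s1 where "s1 = \<sigma> (unflatten v1)"
  have c: "c \<noteq> 0" using v1 by (simp add: r_def c_def)
  have s1: "det s1 = 1" using det_\<sigma> c by (simp add: s1_def c_def)
  \<comment> \<open>The polynomial \<open>r\<close> is nonzero on the full matrix space but might
    vanish on all matrices of determinant 1. The factor \<open>det_diag c\<close> moves the cofactor
    of \<open>g\<close> to the determinant of \<open>v1\<close>, where \<open>r\<close> is known not
    to vanish identically; \<open>\<sigma>\<close> removes the factor again.\<close>
  define \<tau> where "\<tau> v = det_diag c ** matrix_inv (\<sigma> (unflatten v)) ** g" for v
  define D where "D = {v. det (unflatten v :: complex^'m^'m) \<noteq> 0}"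
  have D: "open D" unfolding D_def by (rule open_polynomial_fn_nonzero[OF dpoly])
  \<comment> \<open>\<open>\<tau>\<close> involves division by determinants, so the nonvanishing of
    \<open>r\<close> along it is obtained as an open condition, by continuity.\<close>
  have "continuous_on D (\<lambda>v. det_diag (1 / det (unflatten v :: complex^'m^'m)))"
    unfolding det_diag_def
    by (intro continuous_intros bounded_linear.continuous_on[OF bounded_linear_cscale_left]
        continuous_on_polynomial_fn[OF dpoly]) (simp add: D_def)
  then have "continuous_on D (\<lambda>v. \<sigma> (unflatten v))"
    unfolding \<sigma>_def
    by (intro matrix_mult.continuous_on) (auto simp: unflatten_def intro!: continuous_intros)
  then have "continuous_on D \<tau>"
    unfolding \<tau>_def
    by (intro matrix_mult.continuous_on continuous_on_const continuous_on_matrix_inv)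
       (simp_all add: D_def det_\<sigma>)
  then have "continuous_on D (\<lambda>v. r (flatten (\<tau> v)))"
    by (intro continuous_on_compose2[OF continuous_on_polynomial_fn[OF r, of UNIV]]
        linear_continuous_on_compose[OF _ linear_flatten]) auto
  then have U: "open (D \<inter> (\<lambda>v. r (flatten (\<tau> v))) -` (- {0}))"
    using D by (rule continuous_open_preimage) auto
  \<comment> \<open>The point is chosen so that the second factor becomes \<open>s1\<close> and
    \<open>\<tau>\<close> takes the value \<open>unflatten v1\<close>. The open set of admissible
    \<open>v\<close> is therefore nonempty and contains a point where \<open>r\<close> does not
    vanish either.\<close>
  have "flatten (g ** matrix_inv s1) \<in> D \<inter> (\<lambda>v. r (flatten (\<tau> v))) -` (- {0})"
  proof -
    have det1: "det (g ** matrix_inv s1) = 1" using g det_matrix_inv[OF s1] by (simp add: det_mul)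
    have "(g ** matrix_inv s1) ** (s1 ** matrix_inv g) = g ** (matrix_inv s1 ** s1) ** matrix_inv g"
      by (simp add: matrix_mul_assoc)
    also have "\<dots> = mat 1" using g s1 by (simp add: det_nonzero_inverse)
    finally have "matrix_inv (g ** matrix_inv s1) = s1 ** matrix_inv g" by (rule matrix_inv_eqI)
    moreover have "\<sigma> (g ** matrix_inv s1) = g ** matrix_inv s1"
      by (simp add: \<sigma>_def det1 det_diag_def)
    ultimately have "\<tau> (flatten (g ** matrix_inv s1)) = det_diag c ** s1 ** (matrix_inv g ** g)"
      by (simp add: \<tau>_def matrix_mul_assoc)
    also have "\<dots> = det_diag c ** s1" using g by (simp add: det_nonzero_inverse)
    also have "\<dots> = unflatten v1"
      using c by (simp add: s1_def \<sigma>_def c_def[symmetric] matrix_mul_assoc det_diag_mult)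
        (simp add: det_diag_def)
    finally show ?thesis using v1 by (simp add: D_def det1)
  qed
  from polynomial_fn_nonzero_near[OF r v1 U this]
  obtain v where v: "det (unflatten v :: complex^'m^'m) \<noteq> 0" "r (flatten (\<tau> v)) \<noteq> 0" "r v \<noteq> 0"
    unfolding D_def by blast
  have s: "\<sigma> (unflatten v) \<in> S" using \<sigma>S v(3) by simp
  have "det (\<tau> v) = c"
    using g det_matrix_inv[OF det_\<sigma>[OF v(1)]] by (simp add: \<tau>_def det_mul det_det_diag)
  then have "\<sigma> (\<tau> v) = matrix_inv (\<sigma> (unflatten v)) ** g"
    using c by (simp add: \<sigma>_def[of "\<tau> v"]) (simp add: \<tau>_def matrix_mul_assoc det_diag_mult, simp add: det_diag_def)
  then have "\<sigma> (unflatten v) ** \<sigma> (\<tau> v) = g"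
    using det_\<sigma>[OF v(1)] by (simp add: matrix_mul_assoc det_nonzero_inverse)
  then show ?thesis using mult_S[OF s \<sigma>S[OF v(2)]] by simp
qed

end

section \<open>The representation of sl(2)\<close>

lemma sl2_decomposition:
  assumes "X \<in> (sl :: (complex^2^2) set)"
  shows "X = cscale (X $ 1 $ 1) (matrix_unit 1 1 - matrix_unit 2 2) +
    (cscale (X $ 1 $ 2) (matrix_unit 1 2) + cscale (X $ 2 $ 1) (matrix_unit 2 1))"
proof -
  have "X $ 2 $ 2 = - X $ 1 $ 1" using assms by (simp add: sl_def trace_def sum_2 eq_neg_iff_add_eq_0 add.commute)
  then show ?thesis by (simp add: vec_eq_iff forall_2 cscale_def matrix_unit_nth)
qed

lemma sl2_unit_mem:
  "matrix_unit 1 2 \<in> (sl :: (complex^2^2) set)" "matrix_unit 2 1 \<in> (sl :: (complex^2^2) set)"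
  "matrix_unit 1 1 - matrix_unit 2 2 \<in> (sl :: (complex^2^2) set)"
  "matrix_unit 2 2 - matrix_unit 1 1 \<in> (sl :: (complex^2^2) set)"
  by (simp_all add: sl_def trace_def sum_2 matrix_unit_nth)

text \<open>With \<open>?h\<close> for \<open>?e\<close> and its negative \<open>?h'\<close> for
  \<open>?f\<close>, both root vectors satisfy the nilpotency criterion with eigenvalue 2. If both
  were mapped to 0, then so would be their bracket and all of \<open>sl\<close>, and every line
  would be invariant, against irreducibility in dimension at least 2.\<close>

lemma sl2_nilpotent_image:
  fixes \<rho> :: "complex^2^2 \<Rightarrow> complex^'m^'m"
  assumes irr: "irreducible_sl2_representation \<rho>" and card: "CARD('m) \<ge> 2"
  obtains e K where "e \<in> sl" "\<rho> e \<noteq> 0" "matrix_power (\<rho> e) K = 0"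
proof -
  let ?e = "matrix_unit 1 2 :: complex^2^2" and ?f = "matrix_unit 2 1 :: complex^2^2"
    and ?h = "matrix_unit 1 1 - matrix_unit 2 2 :: complex^2^2"
    and ?h' = "matrix_unit 2 2 - matrix_unit 1 1 :: complex^2^2"
  have rep: "sl2_representation \<rho>" using irr by (simp add: irreducible_sl2_representation_def)
  then have add: "\<And>X Y. X \<in> sl \<Longrightarrow> Y \<in> sl \<Longrightarrow> \<rho> (X + Y) = \<rho> X + \<rho> Y"
    and scale: "\<And>c X. X \<in> sl \<Longrightarrow> \<rho> (cscale c X) = cscale c (\<rho> X)"
    and br: "\<And>X Y. X \<in> sl \<Longrightarrow> Y \<in> sl \<Longrightarrow> \<rho> (lie_bracket X Y) = lie_bracket (\<rho> X) (\<rho> Y)"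
    unfolding sl2_representation_def by blast+
  have sl_scale: "cscale c X \<in> sl" if "X \<in> sl" for c and X :: "complex^2^2"
    using that by (simp add: sl_def trace_cscale)
  have sl_add: "X + Y \<in> sl" if "X \<in> sl" "Y \<in> sl" for X Y :: "complex^2^2"
    using that by (simp add: sl_def trace_add)
  have two: "X + X = cscale 2 X" for X :: "complex^2^2"
    using cscale_add_left[of 1 1 X] by simp
  have he: "lie_bracket ?h ?e = cscale 2 ?e"
    by (simp add: lie_bracket_def matrix_mult.diff_left matrix_mult.diff_right matrix_unit_mult two)
  have hf: "lie_bracket ?h' ?f = cscale 2 ?f"
    by (simp add: lie_bracket_def matrix_mult.diff_left matrix_mult.diff_right matrix_unit_mult two)
  have ef: "lie_bracket ?e ?f = ?h"
    by (simp add: lie_bracket_def matrix_unit_mult)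
  have nil: "\<exists>K. matrix_power (\<rho> ?e) K = 0" "\<exists>K. matrix_power (\<rho> ?f) K = 0"
    using nilpotent_if_lie_bracket[of "\<rho> ?h" "\<rho> ?e"] nilpotent_if_lie_bracket[of "\<rho> ?h'" "\<rho> ?f"]
      br[OF sl2_unit_mem(3,1)] br[OF sl2_unit_mem(4,2)] he hf scale[OF sl2_unit_mem(1)] scale[OF sl2_unit_mem(2)]
    by simp_all
  have "\<rho> ?e \<noteq> 0 \<or> \<rho> ?f \<noteq> 0"
  proof (rule ccontr)
    assume "\<not> ?thesis"
    then have 0: "\<rho> ?e = 0" "\<rho> ?f = 0" by auto
    then have h0: "\<rho> ?h = 0"
      using br[OF sl2_unit_mem(1,2)] ef by (simp add: lie_bracket_def matrix_mult.zero_left)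
    have \<rho>0: "\<rho> X = 0" if "X \<in> sl" for X
      by (subst sl2_decomposition[OF that])
         (simp add: add scale sl_add sl_scale sl2_unit_mem 0 h0)
    fix k :: 'm
    let ?W = "vec.span {axis k 1 :: complex^'m}"
    have "\<forall>X\<in>sl. \<forall>w\<in>?W. \<rho> X *v w \<in> ?W" by (simp add: \<rho>0 vec.span_zero)
    then have "?W = {0} \<or> ?W = UNIV"
      using irr[unfolded irreducible_sl2_representation_def, THEN conjunct2, THEN spec, of ?W]
        vec.subspace_span by blast
    moreover have "?W \<noteq> {0}"
    proof
      assume "?W = {0}"
      moreover have "axis k 1 \<in> ?W" by (rule vec.span_base) simp
      ultimately have "axis k (1 :: complex) = 0" by blast
      then show False by (simp only: axis_eq_0_iff one_neq_zero)
    qed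
    moreover have "?W \<noteq> UNIV"
    proof
      assume "?W = UNIV"
      then have "vec.dim (UNIV :: (complex^'m) set) \<le> card {axis k 1 :: complex^'m}"
        by (intro vec.dim_le_card) simp_all
      then show False using card unfolding vec_dim_card by simp
    qed
    ultimately show False by blast
  qed
  then show ?thesis
    using that[OF sl2_unit_mem(1)] that[OF sl2_unit_mem(2)] nil by blast
qed

theorem theorem5p1:
  fixes n :: nat
    and \<rho> :: "complex^2^2 \<Rightarrow> complex^'m^'m"
    and \<Gamma> :: "(complex^'m^'m) set"
  assumes "n \<ge> 1" and "CARD('m) = n + 1"
    and "irreducible_sl2_representation \<rho>"
    and "\<Gamma> \<subseteq> carrier SL"
    and "exp_subgroup (\<rho> ` sl) \<subseteq> \<Gamma>"
    and "zariski_dense (generate SL \<Gamma>)"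
  shows "generates_as_semigroup SL \<Gamma>"
proof -
  have "CARD('m) \<ge> 2" using assms(1,2) by simp
  then obtain e K where e: "e \<in> sl" "\<rho> e \<noteq> 0" and nil: "matrix_power (\<rho> e) K = 0"
    by (rule sl2_nilpotent_image[OF assms(3)])
  have rep: "sl2_representation \<rho>" using assms(3) by (simp add: irreducible_sl2_representation_def)
  then have Z: "\<rho> e \<in> sl"
    using e(1) unfolding sl2_representation_def by (elim conjE) (rule funcset_mem)
  define S where "S = {foldr (**) xs (mat 1) | xs. xs \<noteq> [] \<and> set xs \<subseteq> \<Gamma>}"
  have foldr_mult: "foldr (**) (xs @ ys) (mat 1) = foldr (**) xs (mat 1) ** foldr (**) ys (mat 1)"
    for xs ys :: "(complex^'m^'m) list"
    by (induction xs) (simp_all add: matrix_mul_assoc)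
  have S_mult: "A ** B \<in> S" if "A \<in> S" "B \<in> S" for A B
  proof -
    obtain xs ys where "xs \<noteq> []" "set xs \<subseteq> \<Gamma>" "set ys \<subseteq> \<Gamma>" "A = foldr (**) xs (mat 1)" "B = foldr (**) ys (mat 1)"
      using \<open>A \<in> S\<close> \<open>B \<in> S\<close> unfolding S_def by blast
    then show ?thesis
      unfolding S_def by (intro CollectI exI[of _ "xs @ ys"]) (simp del: foldr_append add: foldr_mult)
  qed
  have \<Gamma>S: "\<Gamma> \<subseteq> S"
  proof
    fix A assume "A \<in> \<Gamma>"
    then show "A \<in> S" unfolding S_def by (intro CollectI exI[of _ "[A]"]) simp
  qed
  have "det (foldr (**) xs (mat 1)) = 1" if "set xs \<subseteq> carrier SL" for xs :: "(complex^'m^'m) list"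
    using that by (induction xs) (auto simp: det_mul SL_def)
  then have S_det: "det A = 1" if "A \<in> S" for A
    using that assms(4) unfolding S_def by blast
  have exp: "matrix_exp (cscale z (\<rho> e)) \<in> \<Gamma>" for z
  proof -
    have "cscale z e \<in> sl" using e(1) by (simp add: sl_def trace_cscale)
    moreover have "\<rho> (cscale z e) = cscale z (\<rho> e)" using rep e(1) by (simp add: sl2_representation_def)
    ultimately have "matrix_exp (cscale z (\<rho> e)) \<in> matrix_exp ` (\<rho> ` sl)" by (metis imageI)
    then have "matrix_exp (cscale z (\<rho> e)) \<in> exp_subgroup (\<rho> ` sl)"
      unfolding exp_subgroup_def by (rule generate.incl)
    then show ?thesis using assms(5) by blast
  qed
  have S_exp: "matrix_exp (cscale z (\<rho> e)) \<in> S" for z using exp \<Gamma>S by blast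
  \<comment> \<open>\<open>S\<close> consists of products of nonempty lists, so the identity has to
    come from \<open>\<Gamma>\<close> itself, as the exponential of 0.\<close>
  have "mat 1 \<in> S" using S_exp[of 0] by (simp only: matrix_exp_0)
  moreover have "S \<subseteq> carrier SL" using S_det by (auto simp: SL_def)
  ultimately have span: "sl \<subseteq> span (conjugates S (\<rho> e))"
    by (intro span_conjugates[OF _ _ S_mult \<Gamma>S assms(6) Z e(2)])
  interpret unipotent_semigroup S "\<lambda>z. matrix_exp (cscale z (\<rho> e))" "\<rho> e"
    by (rule unipotent_semigroup.intro[OF S_det S_mult S_exp matrix_exp_nilpotent_poly[OF nil]
          matrix_exp_0 matrix_exp_nilpotent_derivative[OF nil] span])
  show ?thesis
    unfolding generates_as_semigroup_def
  proof
    fix g :: "complex^'m^'m" assume "g \<in> carrier SL"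
    then have "g \<in> S" by (intro SL_subset_S) (simp add: SL_def)
    then show "\<exists>xs. xs \<noteq> [] \<and> set xs \<subseteq> \<Gamma> \<and> g = foldr (mult SL) xs \<one>\<^bsub>SL\<^esub>"
      unfolding S_def by (auto simp: SL_def)
  qed
qed

end
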